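(* Let $F(x,y)\in\mathbb{Z}[x,y]$ be a diagonalizable form of degree $r\geq 5$, let $h$ be a positive integer and let $m\geq 3$ be an integer. Let $$H_L=r^{i_4}h^{i_5}|j|^{i_6},$$ with $$i_4=5+\frac{11r-3}{(r-1)^{m-1}},\qquad i_5=2+\frac{2(r-3)}{(r-1)^{m-1}},\qquad i_6=\begin{cases}2 & \text{if } |j|\geq 1,\\ \frac{2}{(r-3)(r-1)^{m-1}} & \text{if } |j|<1.\end{cases}$$ Let $H(x,y)=F_{xx}F_{yy}-F_{xy}^2$ be the Hessian of $F(x,y)$. Then the number of primitive solutions $(x,y)\in\mathbb{Z}^2$ of $0<|F(x,y)|\leq h$ satisfying $|H(x,y)|\geq H_L$ is bounded by $$\begin{cases} rm & \text{if } D<0,\\ 2m & \text{if } D>0,\ r \text{ is even and } F \text{ is indefinite},\\ m & \text{if } D>0,\ r \text{ is odd and } F \text{ is indefinite},\\ 1 & \text{if } D>0 \text{ and } F \text{ is definite}.\end{cases}$$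
   Context: A binary form $F(x,y)\in\mathbb{Z}[x,y]$ of degree $r$ is called diagonalizable if it can be written as $F(x,y)=(\alpha x+\beta y)^r-(\gamma x+\delta y)^r$ with (complex) constants $\alpha,\beta,\gamma,\delta$ satisfying $j=\alpha\delta-\beta\gamma\neq 0$. For such a form one can write $(\alpha x+\beta y)(\gamma x+\delta y)=\chi(Ax^2+Bxy+Cy^2)$ with $A,B,C\in\mathbb{Z}$ and a constant $\chi$; put $D=D(F)=B^2-4AC$ (which is nonzero). $F$ is definite if $F(x,y)$ takes values of only one strict sign for real $(x,y)\neq(0,0)$, and indefinite if it takes both signs. A solution $(x,y)\in\mathbb{Z}^2$ is primitive if $\gcd(x,y)=1$; $(x,y)$ and $(-x,-y)$ are counted as one solution. *)

theory Defs
  imports Complex_Main "HOL-Computational_Algebra.Polynomial"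
begin

text \<open>A polynomial in two variables over a ring \<open>R\<close> is an element of \<open>R[x][y]\<close>:
  the coefficient of \<open>x\<^sup>i y\<^sup>k\<close> in \<open>F\<close> is \<open>coeff (coeff F k) i\<close>.\<close>

definition eval2 :: "'a::comm_ring_1 poly poly \<Rightarrow> 'a \<Rightarrow> 'a \<Rightarrow> 'a" where
  "eval2 F x y = poly (poly F [:y:]) x"

definition of_int_poly2 :: "int poly poly \<Rightarrow> 'a::comm_ring_1 poly poly" where
  "of_int_poly2 F = map_poly (map_poly of_int) F"

definition binary_form :: "nat \<Rightarrow> int poly poly \<Rightarrow> bool" where
  "binary_form r F \<longleftrightarrow>
     F \<noteq> 0 \<and> (\<forall>i k. coeff (coeff F k) i \<noteq> 0 \<longrightarrow> i + k = r)"

text \<open>The polynomials \<open>a x + b y\<close> and \<open>a x\<^sup>2 + b x y + c y\<^sup>2\<close>.\<close>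

definition linear_form :: "'a::comm_ring_1 \<Rightarrow> 'a \<Rightarrow> 'a poly poly" where
  "linear_form a b = [:[:0, a:], [:b:]:]"

definition quadratic_form :: "'a::comm_ring_1 \<Rightarrow> 'a \<Rightarrow> 'a \<Rightarrow> 'a poly poly" where
  "quadratic_form a b c = [:[:0, 0, a:], [:0, b:], [:c:]:]"

definition diagonalization ::
    "nat \<Rightarrow> int poly poly \<Rightarrow> complex \<Rightarrow> complex \<Rightarrow> complex \<Rightarrow> complex \<Rightarrow> bool" where
  "diagonalization r F \<alpha> \<beta> \<gamma> \<delta> \<longleftrightarrow>
     of_int_poly2 F = linear_form \<alpha> \<beta> ^ r - linear_form \<gamma> \<delta> ^ r \<and> \<alpha> * \<delta> - \<beta> * \<gamma> \<noteq> 0"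

definition associated_quadratic ::
    "complex \<Rightarrow> complex \<Rightarrow> complex \<Rightarrow> complex \<Rightarrow> complex \<Rightarrow> int \<Rightarrow> int \<Rightarrow> int \<Rightarrow> bool" where
  "associated_quadratic \<alpha> \<beta> \<gamma> \<delta> c A B C \<longleftrightarrow>
     linear_form \<alpha> \<beta> * linear_form \<gamma> \<delta> =
       smult [:c:] (quadratic_form (of_int A) (of_int B) (of_int C))"

definition definite_form :: "int poly poly \<Rightarrow> bool" where
  "definite_form F \<longleftrightarrow>
     (\<forall>x y :: real. (x, y) \<noteq> (0, 0) \<longrightarrow> eval2 (of_int_poly2 F) x y > 0) \<or>
     (\<forall>x y :: real. (x, y) \<noteq> (0, 0) \<longrightarrow> eval2 (of_int_poly2 F) x y < 0)"

definition indefinite_form :: "int poly poly \<Rightarrow> bool" where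
  "indefinite_form F \<longleftrightarrow>
     (\<exists>x y :: real. eval2 (of_int_poly2 F) x y > 0) \<and>
     (\<exists>x y :: real. eval2 (of_int_poly2 F) x y < 0)"

definition partial_x :: "int poly poly \<Rightarrow> int poly poly" where
  "partial_x F = map_poly pderiv F"

definition partial_y :: "int poly poly \<Rightarrow> int poly poly" where
  "partial_y F = pderiv F"

definition hessian :: "int poly poly \<Rightarrow> int poly poly" where
  "hessian F =
     partial_x (partial_x F) * partial_y (partial_y F) - (partial_y (partial_x F))\<^sup>2"

text \<open>In \<open>i6\<close> and \<open>H_L\<close>, \<open>J\<close> stands for \<open>\<bar>j\<bar>\<close>, where \<open>j = \<alpha>\<delta> - \<beta>\<gamma>\<close>.\<close>

definition i4 :: "nat \<Rightarrow> nat \<Rightarrow> real" where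
  "i4 r m = 5 + (11 * real r - 3) / (real r - 1) ^ (m - 1)"

definition i5 :: "nat \<Rightarrow> nat \<Rightarrow> real" where
  "i5 r m = 2 + 2 * (real r - 3) / (real r - 1) ^ (m - 1)"

definition i6 :: "nat \<Rightarrow> nat \<Rightarrow> real \<Rightarrow> real" where
  "i6 r m J = (if J \<ge> 1 then 2 else 2 / ((real r - 3) * (real r - 1) ^ (m - 1)))"

definition H_L :: "nat \<Rightarrow> nat \<Rightarrow> nat \<Rightarrow> real \<Rightarrow> real" where
  "H_L r h m J = real r powr i4 r m * real h powr i5 r m * J powr i6 r m J"

definition primitive_solutions :: "int poly poly \<Rightarrow> nat \<Rightarrow> real \<Rightarrow> (int \<times> int) set" where
  "primitive_solutions F h T =
     {(x, y). coprime x y \<and> 0 < \<bar>eval2 F x y\<bar> \<and> \<bar>eval2 F x y\<bar> \<le> int h \<and>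
              real_of_int \<bar>eval2 (hessian F) x y\<bar> \<ge> T}"

text \<open>Solutions up to sign: the classes \<open>{(x, y), (-x, -y)}\<close>.\<close>

definition up_to_sign :: "(int \<times> int) set \<Rightarrow> (int \<times> int) set set" where
  "up_to_sign S = (\<lambda>(x, y). {(x, y), (- x, - y)}) ` S"

definition at_most_up_to_sign :: "(int \<times> int) set \<Rightarrow> nat \<Rightarrow> bool" where
  "at_most_up_to_sign S n \<longleftrightarrow> finite (up_to_sign S) \<and> card (up_to_sign S) \<le> n"

end

(*
  Write F = u^r - v^r with linear forms u, v and u v = \<kappa> Q, where Q = (A, B, C) is primitive of
  discriminant D, and put s = j / \<kappa>, so that s^2 = D.  If |F(p)| \<le> h and the Hessian
  -(r (r - 1) j)^2 (u v)^(r - 2) is large at p, then v / u is close to an r-th root of unity; this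
  splits the solutions into at most r classes, and into at most two (one for odd r) if D > 0,
  because cross ratios of values of u and v at integer points are then real.  If D > 0, a large
  solution also forces F to have a nontrivial real zero, so definite forms have none.

  Within a class, the lower bound |j| for |u(p) v(q) - v(p) u(q)| gives the gap principle
  |u(q)| \<ge> |j| |u(p)|^(r - 1) / h.  Hence among m + 1 solutions of one class, the second largest one,
  p, is so large that the hypergeometric method applies to it and the largest one, q: with the
  diagonal Pade approximants P_n, Q_n of x^(1/r) at x = v(p)^r / u(p)^r, the number
  u(p)^(rn) (u(p) v(q) P_n(x) - v(p) u(q) Q_n(x)) is a rational integer times j, up to an explicit
  factor; it is nonzero for n or n + 1, and for a suitable n it is too small.
*)
theory Submission
  imports Defs "HOL-Analysis.Analysis" "HOL-Number_Theory.Cong"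
begin

section \<open>Pade approximants of the r-th root\<close>

text \<open>The coefficients of u and v are merely complex, and |j| may be small or large. All
  arithmetic therefore rests on two integers at each point: F = u^r - v^r, and r s (u^r + v^r), a
  Jacobian. They make 2 r s u^r and 2 r s v^r conjugate in Z[s], and they make 4 r^2 D \<kappa>^r a
  nonzero integer. The latter bounds |j| from below and yields |s| <= r max(1, |j|)^2, which limits
  the denominators met in the hypergeometric method.

  Up to a constant factor P_n is the hypergeometric polynomial 2F1(-n, -n - 1/r; 1 - 1/r; x), and
  Q_n(x) = x^n P_n(1/x). With K = 2 r^3 |s|, passing from n to n + 1 costs a factor 8 K |u(p)|^r in
  the term that comes from the distance of q to its root of unity, and gains |u(p)|^r / (4 r^2 h^2
  K) in the Pade error at p. Nonvanishing is known only for one of two consecutive indices, so both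
  must satisfy the size conditions; the slack for this comes from |u(q)| being of order |u(p)|^(r -
  1) at least, with r - 1 >= 4.\<close>

lemma alternating_binomial_partial_fractions:
  fixes a :: "'a::field_char_0"
  assumes "\<And>i. i \<le> n \<Longrightarrow> a + of_nat i \<noteq> 0"
  shows "(\<Sum>i\<le>n. (-1) ^ i * of_nat (n choose i) / (a + of_nat i)) = fact n / pochhammer a (Suc n)"
  using assms
proof (induction n arbitrary: a)
  case (Suc n)
  have nz: "a + of_nat i \<noteq> 0" if "i \<le> Suc n" for i
    using Suc.prems that by blast
  have IH1: "(\<Sum>i\<le>n. (-1) ^ i * of_nat (n choose i) / (a + of_nat i)) = fact n / pochhammer a (Suc n)"
    by (rule Suc.IH) (use nz in auto)
  have IH2: "(\<Sum>i\<le>n. (-1) ^ i * of_nat (n choose i) / (a + 1 + of_nat i)) = fact n / pochhammer (a + 1) (Suc n)"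
    by (rule Suc.IH) (use nz[of "Suc _"] in \<open>auto simp: add_ac\<close>)
  \<comment> \<open>By Pascal's rule the sum for \<open>Suc n\<close> at \<open>a\<close> is the sum
    for \<open>n\<close> at \<open>a\<close> minus the sum for \<open>n\<close> at
    \<open>a + 1\<close>; the right-hand side obeys the same recursion.\<close>
  have "(\<Sum>i\<le>Suc n. (-1) ^ i * of_nat (Suc n choose i) / (a + of_nat i)) =
     1 / a + (\<Sum>i\<le>n. (-1) ^ Suc i * of_nat (Suc n choose Suc i) / (a + of_nat (Suc i)))"
    by (subst sum.atMost_Suc_shift) simp
  also have "\<dots> = 1 / a + (\<Sum>i\<le>n. (-1) ^ Suc i * of_nat (n choose Suc i) / (a + of_nat (Suc i)))
      - (\<Sum>i\<le>n. (-1) ^ i * of_nat (n choose i) / (a + 1 + of_nat i))"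
  proof -
    have "(-1) ^ Suc i * of_nat (Suc n choose Suc i) / (a + of_nat (Suc i)) =
        (-1) ^ Suc i * of_nat (n choose Suc i) / (a + of_nat (Suc i)) -
        (-1) ^ i * of_nat (n choose i) / (a + 1 + of_nat i)" for i
      by (simp add: add_divide_distrib diff_divide_distrib algebra_simps)
    then show ?thesis by (simp only: sum_subtractf) simp
  qed
  also have "1 / a + (\<Sum>i\<le>n. (-1) ^ Suc i * of_nat (n choose Suc i) / (a + of_nat (Suc i)))
      = (\<Sum>i\<le>Suc n. (-1) ^ i * of_nat (n choose i) / (a + of_nat i))"
    by (subst sum.atMost_Suc_shift) simp
  also have "\<dots> = (\<Sum>i\<le>n. (-1) ^ i * of_nat (n choose i) / (a + of_nat i))"
    by simp
  finally have *: "(\<Sum>i\<le>Suc n. (-1) ^ i * of_nat (Suc n choose i) / (a + of_nat i)) =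
     fact n / pochhammer a (Suc n) - fact n / pochhammer (a + 1) (Suc n)"
    unfolding IH1 IH2 .
  have p0: "pochhammer (a + 1) n \<noteq> 0"
  proof
    assume "pochhammer (a + 1) n = 0"
    then obtain k where "k < n" "a + 1 = - of_nat k" by (auto simp: pochhammer_eq_0_iff)
    then have "a + of_nat (Suc k) = 0" by (simp add: algebra_simps) (metis add.commute add.left_inverse add.assoc)
    then show False using nz[of "Suc k"] \<open>k < n\<close> by auto
  qed
  have a0: "a \<noteq> 0" "a + 1 + of_nat n \<noteq> 0" using nz[of 0] nz[of "Suc n"] by (auto simp: add_ac)
  have e1: "pochhammer a (Suc n) = a * pochhammer (a + 1) n" by (rule pochhammer_rec)
  have e2: "pochhammer (a + 1) (Suc n) = (a + 1 + of_nat n) * pochhammer (a + 1) n" by (rule pochhammer_rec')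
  have e3: "pochhammer a (Suc (Suc n)) = a * ((a + 1 + of_nat n) * pochhammer (a + 1) n)"
    by (subst pochhammer_rec) (simp add: e2)
  show ?case unfolding * e3 e1 e2 using p0 a0 by (simp add: divide_simps) (simp add: algebra_simps)
qed auto

section \<open>Integrality of binomial coefficients at rational arguments\<close>

lemma fact_eq_coprime_times_prime_power:
  fixes p :: nat
  assumes "prime p"
  shows "\<exists>s e. \<not> p dvd s \<and> e \<le> n \<and> fact n = s * p ^ e"
proof (induction n rule: less_induct)
  case (less n)
  \<comment> \<open>Legendre's recursion: the multiples of \<open>p\<close> up to \<open>n\<close>
    contribute \<open>p ^ (n div p) * fact (n div p)\<close>, all other factors are prime to
    \<open>p\<close>.\<close>
  have "\<exists>s. \<not> p dvd s \<and> fact n = s * p ^ (n div p) * fact (n div p)"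
  proof (induction n)
    case 0
    then show ?case using assms by (intro exI[of _ 1]) auto
  next
    case (Suc n)
    then obtain s where s: "\<not> p dvd s" "fact n = s * p ^ (n div p) * fact (n div p)" by blast
    show ?case
    proof (cases "p dvd Suc n")
      case True
      then have q: "Suc n div p = Suc (n div p)" by (metis div_Suc dvd_imp_mod_0)
      have "Suc n = p * Suc (n div p)" using True q by (metis dvd_mult_div_cancel)
      then have "fact (Suc n) = s * p ^ (Suc n div p) * fact (Suc n div p)"
        unfolding q fact_Suc s(2) by (simp only: power_Suc of_nat_id mult_ac)
      then show ?thesis using s by blast
    next
      case False
      then have q: "Suc n div p = n div p" by (metis div_Suc mod_0_imp_dvd)
      have "\<not> p dvd Suc n * s" using False s(1) assms prime_dvd_mult_iff by blast
      moreover have "fact (Suc n) = (Suc n * s) * p ^ (Suc n div p) * fact (Suc n div p)"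
        unfolding q fact_Suc s(2) by (simp only: of_nat_id mult_ac)
      ultimately show ?thesis by blast
    qed
  qed
  then obtain s where s: "\<not> p dvd s" "fact n = s * p ^ (n div p) * fact (n div p)" by blast
  show ?case
  proof (cases "n = 0")
    case True
    then show ?thesis using assms by (intro exI[of _ 1] exI[of _ 0]) auto
  next
    case False
    have p2: "p \<ge> 2" using assms prime_ge_2_nat by blast
    have "n div p < n" using False p2 by (simp add: div_less_dividend)
    from less[OF this] obtain s' e where s': "\<not> p dvd s'" "e \<le> n div p" "fact (n div p) = s' * p ^ e"
      by blast
    \<comment> \<open>The exponent is at most twice \<open>n div p\<close>, hence at most
      \<open>n\<close>.\<close>
    have "n div p \<le> n div 2" using p2 by (simp add: div_le_mono2)
    then have "n div p + e \<le> n" using s'(2) by linarith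
    moreover have "fact n = s * s' * p ^ (n div p + e)" unfolding s(2) s'(3) by (simp add: power_add)
    moreover have "\<not> p dvd s * s'" using s(1) s'(1) assms prime_dvd_mult_iff by blast
    ultimately show ?thesis by blast
  qed
qed

lemma prod_congr_pochhammer:
  fixes a r r' N :: int
  assumes "[r * r' = 1] (mod N)"
  shows "[(\<Prod>i<k. a + int i * r) = r ^ k * pochhammer (a * r') k] (mod N)"
proof -
  have "[a + int i * r = r * (a * r' + int i)] (mod N)" for i
  proof -
    have "[a * 1 + int i * r = a * (r * r') + int i * r] (mod N)"
      by (intro cong_add cong_mult cong_refl cong_sym[OF assms])
    then show ?thesis by (simp add: algebra_simps)
  qed
  then have "[(\<Prod>i<k. a + int i * r) = (\<Prod>i<k. r * (a * r' + int i))] (mod N)"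
    by (intro cong_prod)
  then show ?thesis by (simp add: pochhammer_prod prod.distrib atLeast0LessThan)
qed

text \<open>One prime \<open>q\<close> at a time. If \<open>q\<close> divides \<open>r\<close>, its
  exponent in \<open>fact k\<close> is at most \<open>k\<close> and \<open>r ^ k\<close> absorbs it.
  Otherwise \<open>r\<close> is invertible modulo the relevant power of \<open>q\<close>, and there
  the progression is \<open>r ^ k\<close> times a rising factorial, which \<open>fact k\<close>
  divides.\<close>

lemma fact_dvd_power_mult_progression:
  fixes a r :: int
  assumes "r \<noteq> 0"
  shows "fact k dvd r ^ k * (\<Prod>i<k. a + int i * r)"
proof (cases "(\<Prod>i<k. a + int i * r) = 0")
  case False
  let ?P = "\<Prod>i<k. a + int i * r"
  have "multiplicity q (fact k) \<le> multiplicity q (r ^ k * ?P)" if q: "prime q" for q :: int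
  proof -
    have nz: "r ^ k * ?P \<noteq> 0" "\<not> is_unit q" using False assms q by auto
    show ?thesis
    proof (cases "q dvd r")
      case True
      have "prime (nat q)" using q prime_int_nat_transfer by blast
      moreover have "int (nat q) = q" using prime_ge_0_int[OF q] by simp
      ultimately obtain s e where s: "\<not> nat q dvd s" "e \<le> k" "fact k = s * nat q ^ e"
        using fact_eq_coprime_times_prime_power by blast
      have s3: "(fact k :: int) = int s * q ^ e"
        using arg_cong[OF s(3), of int] prime_ge_0_int[OF q] by simp
      have "\<not> q dvd int s" using s(1) prime_ge_0_int[OF q] by (metis int_dvd_int_iff nat_0_le)
      then have "\<not> q ^ Suc e dvd fact k"
        unfolding s3 using q by (auto simp: prime_ge_0_int)
      then have "multiplicity q (fact k) = e"
        by (intro multiplicity_eqI) (auto simp: s3)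
      also have "\<dots> \<le> k" by fact
      also have "k \<le> multiplicity q (r ^ k * ?P)"
        using nz True by (intro multiplicity_geI dvd_mult2 dvd_power_same) auto
      finally show ?thesis .
    next
      case False
      define N where "N = q ^ multiplicity q (fact k)"
      have "coprime r N"
        unfolding N_def using False q prime_imp_coprime coprime_commute by auto
      then obtain r' where r': "[r * r' = 1] (mod N)"
        using cong_solve_coprime_int by blast
      have "N dvd fact k" unfolding N_def by (rule multiplicity_dvd)
      then have "N dvd pochhammer (a * r') k" using fact_dvd_pochhammer dvd_trans by blast
      then have "N dvd ?P" using prod_congr_pochhammer[OF r', of a k]
        by (simp add: cong_dvd_iff)
      then show ?thesis using nz unfolding N_def by (intro multiplicity_geI dvd_mult) auto
    qed
  qed
  then show ?thesis by (intro multiplicity_le_imp_dvd) auto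
next
  case True
  then show ?thesis by (simp only: mult_zero_right dvd_0_right)
qed

text \<open>One factor \<open>r ^ k\<close> clears the denominators of the \<open>k\<close> factors
  \<open>a / r - i\<close>; the other one makes the resulting numerator divisible by
  \<open>fact k\<close>. The progression descends, so the preceding lemma is applied with step
  \<open>- r\<close>.\<close>

lemma integral_gbinomial:
  fixes a :: int and r :: nat
  assumes "r > 0"
  shows "\<exists>z. real r ^ (2 * k) * ((of_int a / real r) gchoose k) = of_int z"
proof -
  have "fact k dvd (- int r) ^ k * (\<Prod>i<k. a + int i * (- int r))"
    by (rule fact_dvd_power_mult_progression) (use assms in auto)
  then have "fact k dvd int r ^ k * (\<Prod>i<k. a - int i * int r)"
    by (cases "even k") (simp_all add: power_minus[of "int r"])
  then obtain z where z: "int r ^ k * (\<Prod>i<k. a - int i * int r) = fact k * z" by blast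
  have "(of_int a / real r) gchoose k = (\<Prod>i<k. (of_int a - real i * real r) / real r) / fact k"
    unfolding gbinomial_prod_rev atLeast0LessThan
    by (intro arg_cong2[where f = "(/)"] prod.cong refl) (use assms in \<open>simp add: field_simps\<close>)
  also have "\<dots> = (\<Prod>i<k. of_int a - real i * real r) / real r ^ k / fact k"
    by (simp add: prod_dividef)
  finally have "real r ^ (2 * k) * ((of_int a / real r) gchoose k) =
      of_int (int r ^ k * (\<Prod>i<k. a - int i * int r)) / fact k"
    using assms by (simp add: mult_2 power_add)
  also have "\<dots> = of_int z" unfolding z by simp
  finally show ?thesis by blast
qed

text \<open>The approximation is \<open>pade_num r n x - x powr (1 / r) * pade_den r n x = O((x - 1) ^ (2 * n + 1))\<close>
  at \<open>x = 1\<close>; below, \<open>x\<close> is given as \<open>w ^ r\<close> with \<open>w\<close> close to 1, which avoids branches of the root.\<close>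

definition pade_coeff :: "nat \<Rightarrow> nat \<Rightarrow> nat \<Rightarrow> real" where
  "pade_coeff r n k = ((real n + 1 / real r) gchoose k) * ((real n - 1 / real r) gchoose (n - k))"

definition pade_num :: "nat \<Rightarrow> nat \<Rightarrow> complex \<Rightarrow> complex" where
  "pade_num r n x = (\<Sum>k\<le>n. of_real (pade_coeff r n k) * x ^ k)"

definition pade_den :: "nat \<Rightarrow> nat \<Rightarrow> complex \<Rightarrow> complex" where
  "pade_den r n x = (\<Sum>k\<le>n. of_real (pade_coeff r n k) * x ^ (n - k))"

lemma gbinomial_pos:
  fixes a :: real
  assumes "a > real k - 1"
  shows "a gchoose k > 0"
  unfolding gbinomial_prod_rev by (intro divide_pos_pos prod_pos) (use assms in auto)

text \<open>Nonnegativity means that the sum of the absolute values of the coefficients is their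
  plain sum, a central binomial coefficient by Vandermonde.\<close>

lemma pade_coeff_nonneg:
  assumes "r > 1" "k \<le> n"
  shows "pade_coeff r n k \<ge> 0"
proof -
  have "1 / real r \<ge> 0" by simp
  then have "real n + 1 / real r > real k - 1" using assms(2) by linarith
  moreover have "1 / real r < 1" using assms by simp
  then have "real n - 1 / real r > real (n - k) - 1" using assms by linarith
  ultimately show ?thesis unfolding pade_coeff_def by (intro mult_nonneg_nonneg less_imp_le gbinomial_pos)
qed

lemma sum_pade_coeff_le:
  "(\<Sum>k\<le>n. pade_coeff r n k) \<le> 4 ^ n"
proof -
  have "(\<Sum>k\<le>n. pade_coeff r n k) = (real (2 * n) gchoose n)"
    unfolding pade_coeff_def atMost_atLeast0 gbinomial_Vandermonde by simp
  also have "\<dots> = real ((2 * n) choose n)" by (simp add: binomial_gbinomial)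
  also have "\<dots> \<le> real (2 ^ (2 * n))" by (intro of_nat_mono binomial_le_pow2)
  also have "\<dots> = 4 ^ n" by (simp add: power_mult)
  finally show ?thesis .
qed

lemma pade_coeff_integral:
  assumes "r > 0" "k \<le> n"
  shows "\<exists>z. real r ^ (2 * n) * pade_coeff r n k = of_int z"
proof -
  have "real n + 1 / real r = of_int (int n * int r + 1) / real r"
       "real n - 1 / real r = of_int (int n * int r - 1) / real r"
    using assms by (auto simp: field_simps)
  then obtain z1 z2 where
    "real r ^ (2 * k) * ((real n + 1 / real r) gchoose k) = of_int z1"
    "real r ^ (2 * (n - k)) * ((real n - 1 / real r) gchoose (n - k)) = of_int z2"
    using integral_gbinomial[OF assms(1)] by metis
  moreover have "2 * n = 2 * k + 2 * (n - k)" using assms(2) by simp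
  then have "real r ^ (2 * n) = real r ^ (2 * k) * real r ^ (2 * (n - k))"
    by (metis power_add)
  ultimately have "real r ^ (2 * n) * pade_coeff r n k = of_int (z1 * z2)"
    unfolding pade_coeff_def by (simp add: mult_ac)
  then show ?thesis by blast
qed

section \<open>The approximation error as an integral\<close>

definition pade_norm :: "nat \<Rightarrow> nat \<Rightarrow> real" where
  "pade_norm r n = (-1) ^ n * real r * pochhammer (1 / real r - real n) (2 * n + 1) / (fact n)\<^sup>2"

text \<open>Pairing the factors \<open>1 / r - i\<close> and \<open>1 / r + i\<close> shows that
  \<open>pade_norm r n\<close> is the product of \<open>1 - 1 / (r * i) ^ 2\<close> over
  \<open>i\<close> from 1 to \<open>n\<close>. The induction adds one factor at each end of the
  rising factorial.\<close>

lemma abs_pade_norm_le_1: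
  assumes "r > 1"
  shows "\<bar>pade_norm r n\<bar> \<le> 1"
proof -
  have "\<bar>pochhammer (1 / real r - real n) (2 * n + 1)\<bar> \<le> 1 / real r * (fact n)\<^sup>2"
  proof (induction n)
    case (Suc n)
    let ?v = "1 / real r"
    have v: "0 \<le> ?v" "?v \<le> 1" using assms by auto
    have "2 * Suc n + 1 = Suc (Suc (2 * n + 1))" by simp
    moreover have "x - real (Suc n) + 1 = x - real n" for x by simp
    ultimately have "pochhammer (?v - real (Suc n)) (2 * Suc n + 1) =
        (?v - real (Suc n)) * pochhammer (?v - real n) (Suc (2 * n + 1))"
      by (simp only: pochhammer_rec[of "?v - real (Suc n)"])
    also have "pochhammer (?v - real n) (Suc (2 * n + 1)) = (?v + real (Suc n)) * pochhammer (?v - real n) (2 * n + 1)"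
    proof -
      have "x - real n + real (2 * n + 1) = x + real (Suc n)" for x by simp
      then show ?thesis by (simp only: pochhammer_rec')
    qed
    finally have "\<bar>pochhammer (?v - real (Suc n)) (2 * Suc n + 1)\<bar> =
       \<bar>(?v - real (Suc n)) * (?v + real (Suc n))\<bar> * \<bar>pochhammer (?v - real n) (2 * n + 1)\<bar>"
      by (simp only: abs_mult mult_ac)
    also have "(?v - real (Suc n)) * (?v + real (Suc n)) = - ((real (Suc n))\<^sup>2 - ?v\<^sup>2)"
    proof -
      have "(x - y) * (x + y) = - (y\<^sup>2 - x\<^sup>2)" for x y :: real
        by (simp add: algebra_simps power2_eq_square)
      then show ?thesis .
    qed
    also have "\<bar>- ((real (Suc n))\<^sup>2 - ?v\<^sup>2)\<bar> \<le> (real (Suc n))\<^sup>2"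
    proof -
      have "?v\<^sup>2 \<le> (real (Suc n))\<^sup>2" by (rule power_mono) (use v in auto)
      moreover have "0 \<le> ?v\<^sup>2" by simp
      ultimately show ?thesis by linarith
    qed
    also have "(real (Suc n))\<^sup>2 * \<bar>pochhammer (?v - real n) (2 * n + 1)\<bar> \<le> (real (Suc n))\<^sup>2 * (?v * (fact n)\<^sup>2)"
      by (intro mult_left_mono Suc.IH) auto
    also have "\<dots> = ?v * (fact (Suc n))\<^sup>2" by (simp only: fact_Suc power_mult_distrib mult_ac)
    finally show ?case by (simp add: mult_right_mono)
  qed auto
  then have "real r * \<bar>pochhammer (1 / real r - real n) (2 * n + 1)\<bar> \<le> (fact n)\<^sup>2"
    using assms by (simp add: field_simps)
  then show ?thesis unfolding pade_norm_def
    by (simp add: abs_mult divide_simps power_abs)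
qed

text \<open>The inner sum is what termwise integration of the expanded kernel produces at
  \<open>t = 1\<close>; this identity recognizes the resulting polynomial as the explicit one, whose
  coefficients have known denominators.\<close>

lemma pade_coeff_partial_fractions:
  assumes "r > 1" "k \<le> n"
  shows "pade_coeff r n k = pade_norm r n * ((-1) ^ k * real (n choose k) *
    (\<Sum>i\<le>n. (-1) ^ i * real (n choose i) / (real r * (real i - real k) + 1)))"
proof -
  let ?v = "1 / real r"
  define a where "a = ?v - real k"
  have nz: "a + real i \<noteq> 0" for i
  proof
    assume "a + real i = 0"
    then have "real r * (real k - real i) = 1" using assms by (simp add: a_def field_simps)
    then have "of_int (int r * (int k - int i)) = (1 :: real)" by simp
    then have "int r * (int k - int i) = 1" by (simp only: of_int_eq_1_iff)
    then show False using assms by (simp add: zmult_eq_1_iff)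
  qed
  have "(\<Sum>i\<le>n. (-1) ^ i * real (n choose i) / (real r * (real i - real k) + 1)) =
        (\<Sum>i\<le>n. (-1) ^ i * real (n choose i) / (a + real i) / real r)"
  proof (intro sum.cong refl)
    fix i
    have "real r * (real i - real k) + 1 = (a + real i) * real r"
      using assms by (simp add: a_def field_simps)
    then show "(-1) ^ i * real (n choose i) / (real r * (real i - real k) + 1) =
        (-1) ^ i * real (n choose i) / (a + real i) / real r" by simp
  qed
  also have "\<dots> = fact n / pochhammer a (Suc n) / real r"
    unfolding sum_divide_distrib[symmetric] by (subst alternating_binomial_partial_fractions) (use nz in auto)
  finally have S: "(\<Sum>i\<le>n. (-1) ^ i * real (n choose i) / (real r * (real i - real k) + 1)) =
      fact n / pochhammer a (Suc n) / real r" .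
  have "pochhammer a (Suc n) \<noteq> 0"
  proof
    assume "pochhammer a (Suc n) = 0"
    then obtain i where "a = - real i" by (auto simp: pochhammer_eq_0_iff)
    then show False using nz[of i] by simp
  qed
  \<comment> \<open>The factors of the long rising factorial form three blocks: the first
    \<open>n - k\<close> belong to the second binomial coefficient, the last \<open>k\<close> to the
    first one, and the middle \<open>n + 1\<close> cancel against the partial fractions.\<close>
  have "2 * n + 1 = (n - k) + (Suc n + k)" using assms by simp
  then have "pochhammer (?v - real n) (2 * n + 1) =
      pochhammer (?v - real n) ((n - k) + (Suc n + k))" by (simp only:)
  also have "\<dots> = pochhammer (?v - real n) (n - k) * pochhammer (?v - real n + real (n - k)) (Suc n + k)"
    by (rule pochhammer_product')
  also have "?v - real n + real (n - k) = a" using assms by (simp add: a_def)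
  also have "pochhammer a (Suc n + k) = pochhammer a (Suc n) * pochhammer (a + real (Suc n)) k"
    by (rule pochhammer_product')
  also have "a + real (Suc n) = real n + ?v - real k + 1" by (simp add: a_def)
  finally have P: "pochhammer (?v - real n) (2 * n + 1) = pochhammer (?v - real n) (n - k) *
     (pochhammer a (Suc n) * pochhammer (real n + ?v - real k + 1) k)" .
  have G1: "(real n + ?v) gchoose k = pochhammer (real n + ?v - real k + 1) k / fact k"
    by (rule gbinomial_pochhammer')
  have G2: "(real n - ?v) gchoose (n - k) = (-1) ^ (n - k) * pochhammer (?v - real n) (n - k) / fact (n - k)"
    by (subst gbinomial_pochhammer) simp
  have s: "(-1 :: real) ^ n = (-1) ^ k * (-1) ^ (n - k)" using assms by (simp flip: power_add)
  have kk: "(-1 :: real) ^ k * (-1) ^ k = 1" by (simp flip: power_mult_distrib)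
  show ?thesis
    unfolding S pade_coeff_def pade_norm_def P G1 G2 s binomial_fact[OF assms(2)]
    using \<open>pochhammer a (Suc n) \<noteq> 0\<close> assms(1) kk by (simp add: field_simps power2_eq_square)
qed

lemma sum_reverse_index: "(\<Sum>i\<le>n. f i) = (\<Sum>i\<le>(n::nat). f (n - i))"
  by (rule sum.reindex_bij_witness[of _ "\<lambda>i. n - i" "\<lambda>i. n - i"]) auto

text \<open>The primitive in \<open>t\<close> of \<open>((1 - x / t ^ r) * (1 - t ^ r)) ^ n\<close>: the two terms of the approximation
  are multiples of its values at \<open>1\<close> and at the root \<open>w\<close> of \<open>x\<close>, so the error is an integral
  over the segment from \<open>1\<close> to \<open>w\<close>.\<close>

definition pade_primitive :: "nat \<Rightarrow> nat \<Rightarrow> complex \<Rightarrow> complex \<Rightarrow> complex" where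
  "pade_primitive r n x t = (\<Sum>k\<le>n. \<Sum>i\<le>n. (-1) ^ (i + k) * of_nat (n choose k) * of_nat (n choose i) * x ^ k *
     t powi (int r * (int i - int k) + 1) / (of_nat r * (of_nat i - of_nat k) + 1))"

lemma pade_primitive_1:
  assumes "r > 1"
  shows "of_real (pade_norm r n) * pade_primitive r n x 1 = pade_num r n x"
proof -
  have "pade_primitive r n x 1 = (\<Sum>k\<le>n. of_real ((-1) ^ k * real (n choose k) *
    (\<Sum>i\<le>n. (-1) ^ i * real (n choose i) / (real r * (real i - real k) + 1))) * x ^ k)"
    unfolding pade_primitive_def
    by (simp add: sum_distrib_left sum_distrib_right power_add mult_ac)
  then show ?thesis
    unfolding pade_num_def by (simp add: sum_distrib_left pade_coeff_partial_fractions[OF assms] mult_ac)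
qed

text \<open>At \<open>t = w\<close> the exponent of \<open>x\<close> in a term is \<open>i\<close>
  instead of \<open>k\<close>. Reversing both indices keeps the sign and turns \<open>i - k\<close>
  into \<open>k - i\<close>; after exchanging the sums the coefficients are the same as at 1, but in
  front of \<open>x ^ (n - i)\<close>.\<close>

lemma pade_primitive_root:
  assumes "r > 1" "w \<noteq> 0"
  shows "of_real (pade_norm r n) * pade_primitive r n (w ^ r) w = w * pade_den r n (w ^ r)"
proof -
  let ?x = "w ^ r"
  let ?f = "\<lambda>k i. (-1) ^ (i + k) * of_nat (n choose k) * of_nat (n choose i) * (?x ^ i * w) / (of_nat r * (of_nat i - of_nat k) + 1) :: complex"
  have "?x ^ k * w powi (int r * (int i - int k) + 1) = ?x ^ i * w" for i k
  proof -
    have "?x ^ k * w powi (int r * (int i - int k) + 1) = w powi (int r * int k + (int r * (int i - int k) + 1))"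
      by (subst power_int_add) (use assms in \<open>auto simp: power_int_mult\<close>)
    also have "int r * int k + (int r * (int i - int k) + 1) = int (r * i + 1)"
      by (simp add: algebra_simps)
    also have "w powi int (r * i + 1) = ?x ^ i * w"
      by (simp only: power_int_of_nat power_add power_mult power_one_right)
    finally show ?thesis .
  qed
  then have "pade_primitive r n ?x w = (\<Sum>k\<le>n. \<Sum>i\<le>n. ?f k i)"
    unfolding pade_primitive_def by (intro sum.cong refl) (simp add: mult.assoc)
  also have "\<dots> = (\<Sum>k\<le>n. \<Sum>i\<le>n. ?f (n - k) (n - i))"
    by (subst sum_reverse_index, intro sum.cong refl sum_reverse_index)
  also have "\<dots> = (\<Sum>i\<le>n. \<Sum>k\<le>n. ?f (n - k) (n - i))"
    by (rule sum.swap)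
  also have "\<dots> = (\<Sum>i\<le>n. of_real ((-1) ^ i * real (n choose i) *
    (\<Sum>k\<le>n. (-1) ^ k * real (n choose k) / (real r * (real k - real i) + 1))) * ?x ^ (n - i) * w)"
    (is "_ = (\<Sum>i\<le>n. ?g i)")
  proof (intro sum.cong refl)
    fix i assume i: "i \<in> {..n}"
    have "?f (n - k) (n - i) = of_real ((-1) ^ i * real (n choose i) *
        ((-1) ^ k * real (n choose k) / (real r * (real k - real i) + 1))) * ?x ^ (n - i) * w" if "k \<in> {..n}" for k
    proof -
      have "(n - i) + (n - k) + (i + k) = 2 * n" using i that by simp
      then have "(-1 :: complex) ^ ((n - i) + (n - k)) * (-1) ^ (i + k) = 1"
        by (metis power_add power_even_eq power_one_right minus_one_mult_self power_mult power2_minus one_power2 power_one)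
      then have e: "(-1 :: complex) ^ ((n - i) + (n - k)) = (-1) ^ (i + k)"
        by (metis minus_one_mult_self mult.right_neutral mult.assoc mult.left_neutral)
      have d: "of_nat (n - i) - of_nat (n - k) = (of_nat k - of_nat i :: complex)"
        using i that by (simp add: of_nat_diff)
      have b: "n choose (n - i) = n choose i" "n choose (n - k) = n choose k"
        using i that by (auto simp: binomial_symmetric[symmetric])
      show ?thesis unfolding e d b by (simp add: power_add mult_ac)
    qed
    then show "(\<Sum>k\<le>n. ?f (n - k) (n - i)) = ?g i"
      by (simp add: sum_distrib_left sum_distrib_right)
  qed
  finally show ?thesis
    unfolding pade_den_def by (simp add: sum_distrib_left pade_coeff_partial_fractions[OF assms(1)] mult_ac)
qed

lemma has_field_derivative_pade_primitive:
  assumes "r > 1" "t \<noteq> 0"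
  shows "(pade_primitive r n x has_field_derivative ((1 - x / t ^ r) * (1 - t ^ r)) ^ n) (at t within A)"
proof -
  \<comment> \<open>A zero would give \<open>r * (k - i) = 1\<close>, impossible for
    \<open>r > 1\<close>. Equivalently, no exponent of the integrand is -1, so the primitive
    contains no logarithm.\<close>
  have nz: "(of_nat r * (of_nat i - of_nat k) + 1 :: complex) \<noteq> 0" for i k
  proof
    assume *: "(of_nat r * (of_nat i - of_nat k) + 1 :: complex) = 0"
    have "of_int (int r * (int i - int k) + 1) = (0 :: complex)" using * by simp
    then have "int r * (int k - int i) = 1" by (simp only: of_int_eq_0_iff) (simp add: algebra_simps)
    then show False using assms by (simp add: zmult_eq_1_iff)
  qed
  have "(pade_primitive r n x has_field_derivative
     (\<Sum>k\<le>n. \<Sum>i\<le>n. (-1) ^ (i + k) * of_nat (n choose k) * of_nat (n choose i) * x ^ k *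
     t powi (int r * (int i - int k)))) (at t within A)"
    unfolding pade_primitive_def
  proof (intro DERIV_sum)
    fix k i
    let ?c = "(-1) ^ (i + k) * of_nat (n choose k) * of_nat (n choose i) * x ^ k :: complex"
    let ?d = "of_nat r * (of_nat i - of_nat k) + 1 :: complex"
    have "((\<lambda>t. ?c * t powi (int r * (int i - int k) + 1) / ?d) has_field_derivative
      ?c * (of_int (int r * (int i - int k) + 1) * t powi (int r * (int i - int k) + 1 - 1) * 1) / ?d) (at t within A)"
      by (intro DERIV_cdivide DERIV_cmult DERIV_power_int DERIV_ident) (use assms in auto)
    moreover have "of_int (int r * (int i - int k) + 1) = ?d" by simp
    ultimately show "((\<lambda>t. ?c * t powi (int r * (int i - int k) + 1) / ?d) has_field_derivative
      ?c * t powi (int r * (int i - int k))) (at t within A)"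
      using nz[of i k] by (simp add: mult.assoc)
  qed
  moreover have "(\<Sum>k\<le>n. \<Sum>i\<le>n. (-1) ^ (i + k) * of_nat (n choose k) * of_nat (n choose i) * x ^ k *
     t powi (int r * (int i - int k))) = ((1 - x / t ^ r) * (1 - t ^ r)) ^ n"
  proof -
    have b: "(1 - y) ^ n = (\<Sum>i\<le>n. of_nat (n choose i) * (- y) ^ i)" for y :: complex
      using binomial_ring[of "- y" 1 n] by simp
    have p: "t powi (int r * (int i - int k)) = (t ^ r) ^ i / (t ^ r) ^ k" for i k
    proof -
      have "t powi (int r * (int i - int k)) = (t powi int r) powi (int i - int k)" by (simp add: power_int_mult)
      also have "\<dots> = (t ^ r) ^ i / (t ^ r) ^ k" using assms(2) by (simp add: power_int_diff)
      finally show ?thesis .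
    qed
    show ?thesis
      unfolding power_mult_distrib b sum_product p
      by (intro sum.cong refl) (simp add: power_add power_minus[of "x / t ^ r"] power_minus[of "t ^ r"] power_divide mult_ac)
  qed
  ultimately show ?thesis by simp
qed

text \<open>Factor out \<open>t - 1\<close>. Each term of the remaining geometric sum is at most
  \<open>(1 + e) ^ r\<close>, which is at most \<open>exp (r * e)\<close> and hence at most 2, since
  \<open>r * e\<close> is at most 1/4.\<close>

lemma norm_power_minus_1_le:
  fixes t :: complex
  assumes "norm (t - 1) \<le> e" "4 * real r * e \<le> 1"
  shows "norm (t ^ r - 1) \<le> 2 * real r * e"
proof -
  have e: "e \<ge> 0" using assms(1) norm_ge_zero order_trans by blast
  have "norm t \<le> 1 + e" using norm_triangle_ineq[of "t - 1" 1] assms(1) by simp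
  have "norm (\<Sum>k<r. t ^ k) \<le> (\<Sum>k<r. (1 + e) ^ r)"
  proof (rule sum_norm_le)
    fix k assume k: "k \<in> {..<r}"
    have "norm (t ^ k) \<le> (1 + e) ^ k" unfolding norm_power by (intro power_mono) (use \<open>norm t \<le> 1 + e\<close> in auto)
    also have "\<dots> \<le> (1 + e) ^ r" by (intro power_increasing) (use e k in auto)
    finally show "norm (t ^ k) \<le> (1 + e) ^ r" .
  qed
  also have "\<dots> = real r * (1 + e) ^ r" by simp
  also have "(1 + e) ^ r \<le> exp e ^ r" by (intro power_mono) (use e in auto)
  also have "exp e ^ r = exp (real r * e)" by (simp add: exp_of_nat_mult)
  also have "\<dots> \<le> 2"
  proof -
    have b: "0 \<le> real r * e" "real r * e \<le> 1 / 4" using e assms(2) by auto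
    then have "exp (real r * e) \<le> 1 + real r * e + (real r * e)\<^sup>2" by (intro exp_bound) auto
    moreover have "(real r * e)\<^sup>2 \<le> (1 / 4)\<^sup>2" by (intro power_mono) (use b in auto)
    ultimately show ?thesis using b by (simp add: power2_eq_square)
  qed
  finally have S: "norm (\<Sum>k<r. t ^ k) \<le> real r * 2" by (simp add: mult_left_mono)
  have "norm (t ^ r - 1) = norm (t - 1) * norm (\<Sum>k<r. t ^ k)"
    by (simp add: power_diff_1_eq norm_mult)
  also have "\<dots> \<le> e * (real r * 2)" by (intro mult_mono S assms) (use e in auto)
  finally show ?thesis by (simp add: mult_ac)
qed

text \<open>The mean value inequality for the primitive on the segment replaces an integral
  estimate. The hypothesis keeps \<open>norm (t ^ r)\<close> at least 1/2, away from the pole at 0;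
  the factors \<open>1 - x / t ^ r\<close> and \<open>1 - t ^ r\<close> then contribute 8 and 2 to
  the constant 16.\<close>

lemma pade_error:
  assumes "r > 1" "4 * real r * norm (w - 1) \<le> 1"
  shows "norm (pade_num r n (w ^ r) - w * pade_den r n (w ^ r)) \<le>
    norm (w - 1) * (16 * (real r)\<^sup>2 * (norm (w - 1))\<^sup>2) ^ n"
proof -
  let ?e = "norm (w - 1)" and ?x = "w ^ r"
  have seg: "norm (t - 1) \<le> ?e" if "t \<in> closed_segment 1 w" for t
    using that dist_in_closed_segment[OF that] by (simp add: dist_norm norm_minus_commute)
  have pw: "norm (t ^ r - 1) \<le> 2 * real r * ?e" "2 * real r * ?e \<le> 1 / 2" if "t \<in> closed_segment 1 w" for t
    using norm_power_minus_1_le[OF seg[OF that] assms(2)] assms(2) by auto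
  have half: "norm (t ^ r) \<ge> 1 / 2" if "t \<in> closed_segment 1 w" for t
    using pw[OF that] norm_triangle_ineq2[of 1 "t ^ r"] by (simp add: norm_minus_commute)
  have nz: "t \<noteq> 0" if "t \<in> closed_segment 1 w" for t
    using half[OF that] assms(1) by (auto simp: power_0_left split: if_splits)
  have w: "w \<noteq> 0" by (rule nz) auto
  have "norm (pade_primitive r n ?x 1 - pade_primitive r n ?x w) \<le> (16 * (real r)\<^sup>2 * ?e\<^sup>2) ^ n * norm (1 - w)"
  proof (rule field_differentiable_bound)
    show "convex (closed_segment 1 w)" by simp
    show "(pade_primitive r n ?x has_field_derivative ((1 - ?x / t ^ r) * (1 - t ^ r)) ^ n) (at t within closed_segment 1 w)"
      if "t \<in> closed_segment 1 w" for t
      by (rule has_field_derivative_pade_primitive[OF assms(1) nz[OF that]])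
    show "norm (((1 - ?x / t ^ r) * (1 - t ^ r)) ^ n) \<le> (16 * (real r)\<^sup>2 * ?e\<^sup>2) ^ n"
      if t: "t \<in> closed_segment 1 w" for t
      unfolding norm_power
    proof (rule power_mono)
      have "norm (t ^ r - ?x) \<le> norm (t ^ r - 1) + norm (?x - 1)"
        using norm_triangle_ineq4[of "t ^ r - 1" "?x - 1"] by simp
      also have "\<dots> \<le> 4 * real r * ?e" using pw[OF t] pw[of w] by simp
      finally have 1: "norm (t ^ r - ?x) \<le> 4 * real r * ?e" .
      have "1 - ?x / t ^ r = (t ^ r - ?x) / t ^ r" using nz[OF t] by (simp add: diff_divide_distrib)
      then have "norm (1 - ?x / t ^ r) = norm (t ^ r - ?x) / norm (t ^ r)" by (simp add: norm_divide)
      also have "\<dots> \<le> (4 * real r * ?e) / (1 / 2)" by (intro frac_le 1 half[OF t]) auto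
      finally have 2: "norm (1 - ?x / t ^ r) \<le> 8 * real r * ?e" by simp
      have "norm ((1 - ?x / t ^ r) * (1 - t ^ r)) \<le> (8 * real r * ?e) * (2 * real r * ?e)"
        unfolding norm_mult by (intro mult_mono 2) (use pw[OF t] in \<open>auto simp: norm_minus_commute\<close>)
      then show "norm ((1 - ?x / t ^ r) * (1 - t ^ r)) \<le> 16 * (real r)\<^sup>2 * ?e\<^sup>2"
        by (simp add: power2_eq_square mult_ac)
    qed auto
  qed auto
  then have "norm (of_real (pade_norm r n) * (pade_primitive r n ?x 1 - pade_primitive r n ?x w)) \<le>
     1 * ((16 * (real r)\<^sup>2 * ?e\<^sup>2) ^ n * norm (1 - w))"
    unfolding norm_mult by (intro mult_mono) (use abs_pade_norm_le_1[OF assms(1)] in auto)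
  then show ?thesis
    unfolding right_diff_distrib pade_primitive_1[OF assms(1)] pade_primitive_root[OF assms(1) w]
    by (simp add: mult_ac norm_minus_commute)
qed

lemma norm_pade_coeff_sum_le:
  assumes "r > 1" "norm x \<le> 2" "\<And>k. k \<le> n \<Longrightarrow> e k \<le> n"
  shows "norm (\<Sum>k\<le>n. of_real (pade_coeff r n k) * (x :: complex) ^ e k) \<le> 8 ^ n"
proof -
  have "norm (\<Sum>k\<le>n. of_real (pade_coeff r n k) * x ^ e k) \<le> (\<Sum>k\<le>n. pade_coeff r n k * 2 ^ n)"
  proof (rule sum_norm_le)
    fix k assume k: "k \<in> {..n}"
    have "norm x ^ e k \<le> 2 ^ e k" by (intro power_mono assms) auto
    also have "\<dots> \<le> 2 ^ n" using k assms(3) by (intro power_increasing) auto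
    finally show "norm (of_real (pade_coeff r n k) * x ^ e k) \<le> pade_coeff r n k * 2 ^ n"
      using pade_coeff_nonneg[OF assms(1)] k by (auto simp: norm_mult norm_power intro!: mult_left_mono)
  qed
  also have "\<dots> = (\<Sum>k\<le>n. pade_coeff r n k) * 2 ^ n" by (simp add: sum_distrib_right)
  also have "\<dots> \<le> 4 ^ n * 2 ^ n" by (intro mult_right_mono sum_pade_coeff_le) auto
  also have "\<dots> = 8 ^ n" by (simp flip: power_mult_distrib)
  finally show ?thesis .
qed

lemma norm_pade_num_le:
  assumes "r > 1" "norm x \<le> 2"
  shows "norm (pade_num r n x) \<le> 8 ^ n"
  unfolding pade_num_def by (rule norm_pade_coeff_sum_le) (use assms in auto)

lemma norm_pade_den_le:
  assumes "r > 1" "norm x \<le> 2"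
  shows "norm (pade_den r n x) \<le> 8 ^ n"
  unfolding pade_den_def by (rule norm_pade_coeff_sum_le) (use assms in auto)

section \<open>Nonvanishing for one of two consecutive indices\<close>

lemma poly_eq_smult_power_if_small:
  fixes p :: "complex poly"
  assumes "degree p \<le> d" "r > 0" "\<delta> > 0"
    and le: "\<And>w. norm (w - 1) \<le> \<delta> \<Longrightarrow> norm (poly p (w ^ r)) \<le> K * norm (w - 1) ^ d"
  shows "\<exists>c. p = smult c ([:-1, 1:] ^ d)"
proof (cases "p = 0")
  case True
  then show ?thesis by (intro exI[of _ 0]) simp
next
  case False
  define k where "k = order 1 p"
  obtain g where g: "p = [:-1, 1:] ^ k * g" "\<not> [:-1, 1:] dvd g"
    using order_decomp[OF False, of 1] unfolding k_def by auto
  have g1: "poly g 1 \<noteq> 0" using g(2) by (simp add: poly_eq_0_iff_dvd)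
  have g0: "g \<noteq> 0" using g1 by auto
  have deg: "degree p = k + degree g"
    unfolding g(1) by (subst degree_mult_eq) (use g0 in \<open>auto simp: degree_linear_power\<close>)
  show ?thesis
  proof (cases "k < d")
    case True
    \<comment> \<open>If the order \<open>k\<close> of the zero at 1 were less than
      \<open>d\<close>, then dividing by \<open>(t - 1) ^ k\<close>, which is at most
      \<open>(t ^ r - 1) ^ k\<close>, would force \<open>g\<close> to tend to 0 as \<open>t\<close>
      decreases to 1, against \<open>g1\<close>.\<close>
    have "norm (poly g (of_real t ^ r)) \<le> K * (t - 1)" if t: "1 < t" "t \<le> 1 + min \<delta> 1" for t
    proof -
      let ?w = "of_real t :: complex"
      have n: "norm (?w - 1) = t - 1" using t by (metis norm_of_real of_real_1 of_real_diff abs_of_pos diff_gt_0_iff_gt)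
      have "t \<le> t ^ r" using t assms(2) by (intro self_le_power) auto
      have "norm (?w ^ r - 1) = t ^ r - 1"
        using t one_le_power[of t r] by (metis abs_of_nonneg diff_ge_0_iff_ge less_imp_le norm_of_real of_real_1 of_real_diff of_real_power)
      then have "(t - 1) ^ k * norm (poly g (?w ^ r)) \<le> norm (?w ^ r - 1) ^ k * norm (poly g (?w ^ r))"
        using t \<open>t \<le> t ^ r\<close> by (intro mult_right_mono power_mono) auto
      also have "\<dots> = norm (poly p (?w ^ r))" by (simp add: g(1) norm_mult norm_power)
      also have "\<dots> \<le> K * (t - 1) ^ d" using le[of ?w] n t by auto
      also have "\<dots> = (t - 1) ^ k * (K * (t - 1) ^ (d - k))"
        using True by (simp add: mult_ac flip: power_add)
      finally have *: "norm (poly g (?w ^ r)) \<le> K * (t - 1) ^ (d - k)" using t by simp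
      have "K * (t - 1) ^ (d - k) \<ge> 0" using * norm_ge_zero order_trans by blast
      moreover have "(t - 1) ^ (d - k) > 0" using t by simp
      ultimately have "K \<ge> 0" by (auto simp: zero_le_mult_iff)
      moreover have "(t - 1) ^ (d - k) \<le> (t - 1) ^ 1" using t True by (intro power_decreasing) auto
      ultimately show ?thesis using * mult_left_mono by fastforce
    qed
    then have "eventually (\<lambda>t. norm (poly g (of_real t ^ r)) \<le> K * (t - 1)) (at_right 1)"
      unfolding eventually_at_right_field using assms(3) by (intro exI[of _ "1 + min \<delta> 1"]) auto
    moreover have "((\<lambda>t. norm (poly g (of_real t ^ r))) \<longlongrightarrow> norm (poly g (of_real 1 ^ r))) (at_right 1)"
      by (intro tendsto_intros)
    moreover have "((\<lambda>t. K * (t - 1)) \<longlongrightarrow> K * (1 - 1)) (at_right 1)"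
      by (intro tendsto_intros)
    ultimately have "norm (poly g (of_real 1 ^ r)) \<le> K * (1 - 1)"
      using tendsto_le[OF trivial_limit_at_right_real] by blast
    then show ?thesis using g1 by simp
  next
    case False
    then have "k = d" "degree g = 0" using deg assms(1) by auto
    then show ?thesis using g(1) by (metis degree_eq_zeroE mult.commute mult_pCons_left mult_zero_left pCons_0_0 add.right_neutral)
  qed
qed

text \<open>The determinant has degree at most \<open>2 * n + 1\<close>. Being a combination of the
  two approximation errors it also vanishes to that order at 1, so it is a multiple of
  \<open>(x - 1) ^ (2 * n + 1)\<close>. A zero elsewhere would make it vanish identically, which its
  value at 0 refutes.\<close>

lemma pade_det_neq_0:
  assumes "r > 1" "x \<noteq> 1"
  shows "pade_num r n x * pade_den r (Suc n) x \<noteq> pade_num r (Suc n) x * pade_den r n x"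
proof
  assume eq: "pade_num r n x * pade_den r (Suc n) x = pade_num r (Suc n) x * pade_den r n x"
  define P where "P n = (\<Sum>k\<le>n. monom (complex_of_real (pade_coeff r n k)) k)" for n
  define Q where "Q n = (\<Sum>k\<le>n. monom (complex_of_real (pade_coeff r n k)) (n - k))" for n
  have P: "poly (P n) x = pade_num r n x" and Q: "poly (Q n) x = pade_den r n x" for n x
    by (simp_all add: P_def Q_def pade_num_def pade_den_def poly_sum poly_monom)
  have dP: "degree (P n) \<le> n" and dQ: "degree (Q n) \<le> n" for n
    unfolding P_def Q_def by (intro degree_sum_le; auto intro: order_trans[OF degree_monom_le])+
  define p where "p = P n * Q (Suc n) - P (Suc n) * Q n"
  have pp: "poly p x = pade_num r n x * pade_den r (Suc n) x - pade_num r (Suc n) x * pade_den r n x" for x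
    by (simp add: p_def P Q)
  have "\<exists>c. p = smult c ([:-1, 1:] ^ (2 * n + 1))"
  proof (rule poly_eq_smult_power_if_small)
    show "degree p \<le> 2 * n + 1" unfolding p_def
      using dP[of n] dQ[of "Suc n"] dP[of "Suc n"] dQ[of n] degree_mult_le[of "P n" "Q (Suc n)"] degree_mult_le[of "P (Suc n)" "Q n"]
      by (intro degree_diff_le) auto
    show "r > 0" "1 / (4 * real r) > 0" using assms by auto
    fix w :: complex assume w: "norm (w - 1) \<le> 1 / (4 * real r)"
    let ?e = "norm (w - 1)" and ?x = "w ^ r" and ?b = "16 * (real r)\<^sup>2"
    have w': "4 * real r * ?e \<le> 1" using w assms by (simp add: field_simps)
    have e1: "?e \<le> 1"
    proof -
      have "1 / (4 * real r) \<le> 1" using assms by (simp add: field_simps)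
      then show ?thesis using w by linarith
    qed
    have "norm (?x - 1) \<le> 2 * real r * ?e" using norm_power_minus_1_le[OF _ w'] by simp
    then have x2: "norm ?x \<le> 2" using w' norm_triangle_ineq[of "?x - 1" 1] by simp
    have R: "norm (pade_num r m ?x - w * pade_den r m ?x) \<le> ?e * (?b * ?e\<^sup>2) ^ m" for m
      using pade_error[OF assms(1) w'] .
    have pw: "e * (b * e\<^sup>2) ^ m = b ^ m * e ^ (2 * m + 1)" for e b :: real and m
      by (simp add: power_mult_distrib mult_ac flip: power_mult)
    have R1: "norm (pade_num r n ?x - w * pade_den r n ?x) \<le> ?b ^ n * ?e ^ (2 * n + 1)"
      using R[of n] by (subst pw[symmetric])
    have "norm (pade_num r (Suc n) ?x - w * pade_den r (Suc n) ?x) \<le> ?b ^ Suc n * ?e ^ (2 * Suc n + 1)"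
      using R[of "Suc n"] by (subst pw[symmetric])
    also have "\<dots> \<le> ?b ^ Suc n * ?e ^ (2 * n + 1)"
      by (intro mult_left_mono power_decreasing) (use e1 in auto)
    finally have R2: "norm (pade_num r (Suc n) ?x - w * pade_den r (Suc n) ?x) \<le> ?b ^ Suc n * ?e ^ (2 * n + 1)" .
    have "poly p ?x = (pade_num r n ?x - w * pade_den r n ?x) * pade_den r (Suc n) ?x
        - (pade_num r (Suc n) ?x - w * pade_den r (Suc n) ?x) * pade_den r n ?x"
      by (simp add: pp algebra_simps)
    then have "norm (poly p ?x) \<le> norm (pade_num r n ?x - w * pade_den r n ?x) * norm (pade_den r (Suc n) ?x)
        + norm (pade_num r (Suc n) ?x - w * pade_den r (Suc n) ?x) * norm (pade_den r n ?x)"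
      by (metis norm_triangle_ineq4 norm_mult)
    also have "\<dots> \<le> (?b ^ n * ?e ^ (2 * n + 1)) * 8 ^ Suc n + (?b ^ Suc n * ?e ^ (2 * n + 1)) * 8 ^ n"
      by (intro add_mono mult_mono R1 R2 norm_pade_den_le assms x2) auto
    also have "\<dots> = (?b ^ n * 8 ^ Suc n + ?b ^ Suc n * 8 ^ n) * ?e ^ (2 * n + 1)"
      by (simp only: ring_distribs mult_ac)
    finally show "norm (poly p ?x) \<le> (?b ^ n * 8 ^ Suc n + ?b ^ Suc n * 8 ^ n) * ?e ^ (2 * n + 1)" .
  qed
  then obtain c where c: "p = smult c ([:-1, 1:] ^ (2 * n + 1))" by blast
  have "poly p x = 0" using eq by (simp add: pp)
  then have "c = 0" using assms(2) unfolding c by simp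
  then have "poly p 0 = 0" using c by simp
  moreover have "pade_num r m 0 = of_real ((real m - 1 / real r) gchoose m)" for m
    by (simp add: pade_num_def power_0_left pade_coeff_def if_distrib[of "\<lambda>z. _ * z"] cong: if_cong)
  moreover have "pade_den r m 0 = of_real ((real m + 1 / real r) gchoose m)" for m
  proof -
    have "pade_den r m 0 = (\<Sum>k\<le>m. if k = m then of_real (pade_coeff r m k) else 0)"
      unfolding pade_den_def by (intro sum.cong) (auto simp: power_0_left)
    then show ?thesis by (simp add: pade_coeff_def)
  qed
  ultimately have "complex_of_real (((real n - 1 / real r) gchoose n) * ((real (Suc n) + 1 / real r) gchoose Suc n)) =
     of_real (((real (Suc n) - 1 / real r) gchoose Suc n) * ((real n + 1 / real r) gchoose n))"
    by (simp add: pp)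
  then have E: "((real n - 1 / real r) gchoose n) * ((real (Suc n) + 1 / real r) gchoose Suc n) =
     ((real (Suc n) - 1 / real r) gchoose Suc n) * ((real n + 1 / real r) gchoose n)"
    by (simp only: of_real_eq_iff)
  let ?g1 = "(real n - 1 / real r) gchoose n" and ?g2 = "(real n + 1 / real r) gchoose n"
  have "1 / real r < 1" "1 / real r > 0" using assms by auto
  have "?g1 > 0" by (rule gbinomial_pos) (use \<open>1 / real r < 1\<close> in linarith)
  have "?g2 > 0" by (rule gbinomial_pos) (use \<open>1 / real r > 0\<close> in linarith)
  have s: "real (Suc n) + 1 / real r = (real n + 1 / real r) + 1" "real (Suc n) - 1 / real r = (real n - 1 / real r) + 1"
    by simp_all
  \<comment> \<open>The two products at 0 share \<open>?g1 * ?g2\<close> and differ only in the sign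
    of \<open>1 / r\<close> in the factor gained from \<open>n\<close> to
    \<open>Suc n\<close>.\<close>
  have "?g1 * ?g2 * ((real n + 1 / real r + 1) / real (Suc n)) = ?g1 * ?g2 * ((real n - 1 / real r + 1) / real (Suc n))"
    using E unfolding s gbinomial_rec by (simp only: mult_ac)
  then have "(real n + 1 / real r + 1) / real (Suc n) = (real n - 1 / real r + 1) / real (Suc n)"
    using \<open>?g1 > 0\<close> \<open>?g2 > 0\<close> by simp
  then have "real n + 1 / real r + 1 = real n - 1 / real r + 1"
    by (simp only: divide_cancel_right) simp
  then show False using \<open>1 / real r > 0\<close> by linarith
qed

section \<open>Choice of the degree\<close>

text \<open>\<open>n\<close> is the least positive index satisfying the second inequality. The gap principle (for \<open>n = 1\<close>)
  or minimality (for \<open>n > 1\<close>) then bounds \<open>V\<close> from below, which gives the first one.\<close>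

lemma exists_small_index:
  fixes U V h K J :: real
  assumes pos: "U > 0" "V > 0" "h > 0" "K > 0" "J > 0" and r: "r \<ge> 5"
    and a: "4 * (real r)\<^sup>2 * h\<^sup>2 * K < U ^ r"
    and one: "1 \<le> 8 * K * U ^ r"
    and b: "8 * K * (4 * (real r)\<^sup>2 * h\<^sup>2 * K) ^ 4 \<le> U ^ (3 * r)"
    and c: "(8 * K) ^ 2 * h ^ r < J ^ r * U ^ (r * (r - 4))"
    and gap: "J * U ^ (r - 1) \<le> h * V"
  shows "\<exists>n. \<forall>N\<in>{n, Suc n}. (8 * K * U ^ r) ^ N * U * h * V < J * V ^ r \<and>
     (4 * (real r)\<^sup>2 * h\<^sup>2 * K / U ^ r) ^ N * U * h * V \<le> J * U ^ r"
proof -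
  define L where "L = 4 * (real r)\<^sup>2 * h\<^sup>2 * K"
  define g where "g = U ^ r / L"
  have L: "L > 0" using pos r by (simp add: L_def)
  have g: "g > 1" using a L by (simp add: g_def L_def)
  have Ur: "U ^ r = U * U ^ (r - 1)" using r by (simp flip: power_Suc)
  have "\<exists>n. 0 < n \<and> U * h * V \<le> J * U ^ r * g ^ n"
  proof -
    obtain n where n: "U * h * V / (J * U ^ r) < g ^ n" using real_arch_pow[OF g] by blast
    have "g ^ n \<le> g ^ Suc n" using g by (intro power_increasing) auto
    then have "U * h * V / (J * U ^ r) \<le> g ^ Suc n" using n by linarith
    then have "U * h * V \<le> J * U ^ r * g ^ Suc n" using pos by (simp add: divide_le_eq mult_ac)
    then show ?thesis by blast
  qed
  then obtain n where n: "0 < n" "U * h * V \<le> J * U ^ r * g ^ n"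
    and least: "\<And>k. k < n \<Longrightarrow> \<not> (0 < k \<and> U * h * V \<le> J * U ^ r * g ^ k)"
    by (subst (asm) exists_least_iff) blast
  have low: "J * U ^ r * g ^ (n - 1) \<le> U * h * V"
  proof (cases "n = 1")
    case True
    then show ?thesis using mult_left_mono[OF gap, of U] pos by (simp add: Ur mult_ac)
  next
    case False
    then show ?thesis using least[of "n - 1"] n(1) by auto
  qed
  have low': "J * U ^ (r - 1) / h * g ^ (n - 1) \<le> V"
  proof -
    have "U * (J * U ^ (r - 1) * g ^ (n - 1)) \<le> U * (h * V)" using low by (simp add: Ur mult_ac)
    then have "J * U ^ (r - 1) * g ^ (n - 1) \<le> h * V" using pos by simp
    then show ?thesis using pos by (simp add: field_simps)
  qed
  let ?Z = "8 * K * U ^ r"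
  \<comment> \<open>Raising \<open>n\<close> by one multiplies the left side of the first inequality
    by \<open>?Z\<close> and the lower bound for \<open>V ^ (r - 1)\<close> by
    \<open>g ^ (r - 1)\<close>. Assumption \<open>b\<close> says \<open>?Z \<le> g ^ 4\<close>, so
    the bound keeps pace when \<open>r \<ge> 5\<close>.\<close>
  have Zg: "?Z \<le> g ^ (r - 1)"
  proof -
    have "L ^ 4 > 0" using L by simp
    have "?Z * L ^ 4 = (8 * K * L ^ 4) * U ^ r" by simp
    also have "\<dots> \<le> U ^ (3 * r) * U ^ r" using b pos by (intro mult_right_mono) (auto simp: L_def)
    also have "\<dots> = (U ^ r) ^ 4" by (simp add: mult.commute flip: power_add power_mult)
    finally have "?Z \<le> g ^ 4" using \<open>L ^ 4 > 0\<close> by (simp add: g_def power_divide pos_le_divide_eq)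
    also have "\<dots> \<le> g ^ (r - 1)" using g r by (intro power_increasing) auto
    finally show ?thesis .
  qed
  have e1: "(r - 1) * (r - 1) = 2 * r + 1 + r * (r - 4)"
  proof -
    obtain k where "r = k + 5" using r by (metis add.commute le_Suc_ex)
    then show ?thesis by (simp add: algebra_simps)
  qed
  \<comment> \<open>The case \<open>n = 1\<close>, with exponent 2 because the index may have to be
    \<open>Suc n\<close>. The left side contains \<open>U ^ (2 * r + 1)\<close>, and
    \<open>e1\<close> leaves exactly the power of \<open>U\<close> in assumption
    \<open>c\<close>.\<close>
  have base: "?Z ^ 2 * U * h < J * (J * U ^ (r - 1) / h) ^ (r - 1)"
  proof -
    have "?Z ^ 2 * U * h ^ r = U ^ (2 * r + 1) * ((8 * K) ^ 2 * h ^ r)"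
      by (simp add: power_mult_distrib power2_eq_square power_add mult_2_right mult_ac)
    also have "\<dots> < U ^ (2 * r + 1) * (J ^ r * U ^ (r * (r - 4)))"
      using c pos by (intro mult_strict_left_mono) auto
    also have "\<dots> = J ^ r * U ^ ((r - 1) * (r - 1))" unfolding e1 power_add by (simp only: mult_ac)
    also have "\<dots> = J * (J ^ (r - 1) * (U ^ (r - 1)) ^ (r - 1))"
      using r by (simp add: power_mult flip: power_Suc mult.assoc)
    finally have "?Z ^ 2 * U * h * h ^ (r - 1) < J * (J * U ^ (r - 1)) ^ (r - 1)"
      using r by (simp add: power_mult_distrib mult.assoc flip: power_Suc)
    then show ?thesis using pos by (simp add: power_divide pos_less_divide_eq)
  qed
  have I: "?Z ^ Suc n * U * h < J * V ^ (r - 1)"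
  proof -
    have "Suc n = (n - 1) + 2" using n(1) by simp
    then have "?Z ^ Suc n = ?Z ^ (n - 1) * ?Z ^ 2" by (metis power_add)
    then have "?Z ^ Suc n * U * h = ?Z ^ (n - 1) * (?Z ^ 2 * U * h)" by (simp only: mult_ac)
    also have "\<dots> < ?Z ^ (n - 1) * (J * (J * U ^ (r - 1) / h) ^ (r - 1))"
      using base pos by (intro mult_strict_left_mono) auto
    also have "\<dots> \<le> (g ^ (r - 1)) ^ (n - 1) * (J * (J * U ^ (r - 1) / h) ^ (r - 1))"
      using pos Zg by (intro mult_right_mono power_mono) auto
    also have "\<dots> = J * (J * U ^ (r - 1) / h * g ^ (n - 1)) ^ (r - 1)"
      by (simp only: power_mult_distrib mult_ac flip: power_mult)
    also have "\<dots> \<le> J * V ^ (r - 1)"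
      using pos low' g by (intro mult_left_mono power_mono) auto
    finally show ?thesis .
  qed
  show ?thesis
  proof (intro exI[of _ n] ballI conjI)
    fix N assume N: "N \<in> {n, Suc n}"
    have "?Z ^ N \<le> ?Z ^ Suc n" using N one by (intro power_increasing) auto
    then have "?Z ^ N * (U * h) \<le> ?Z ^ Suc n * (U * h)" using pos by (intro mult_right_mono) auto
    then have "?Z ^ N * U * h < J * V ^ (r - 1)" using I by (simp add: mult.assoc)
    then have "?Z ^ N * U * h * V < J * V ^ (r - 1) * V" using pos by (intro mult_strict_right_mono)
    also have "\<dots> = J * V ^ r" using r by (simp flip: power_Suc2 add: mult.assoc)
    finally show "?Z ^ N * U * h * V < J * V ^ r" .
    have "g ^ n \<le> g ^ N" using N g by (intro power_increasing) auto
    then have "J * U ^ r * g ^ n \<le> J * U ^ r * g ^ N" using pos by (intro mult_left_mono) auto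
    then have "U * h * V \<le> J * U ^ r * g ^ N" using n(2) by linarith
    moreover have "(L / U ^ r) ^ N * g ^ N = 1"
      using pos L by (simp add: g_def flip: power_mult_distrib)
    moreover have "(L / U ^ r) ^ N > 0" using pos L by simp
    ultimately have "(L / U ^ r) ^ N * (U * h * V) \<le> (L / U ^ r) ^ N * (J * U ^ r * g ^ N)"
      by (intro mult_left_mono) auto
    also have "\<dots> = J * U ^ r * ((L / U ^ r) ^ N * g ^ N)" by (simp only: mult_ac)
    finally show "(4 * (real r)\<^sup>2 * h\<^sup>2 * K / U ^ r) ^ N * U * h * V \<le> J * U ^ r"
      using \<open>(L / U ^ r) ^ N * g ^ N = 1\<close> by (simp add: L_def mult.assoc)
  qed
qed

text \<open>Numerical constants are absorbed into powers of \<open>r\<close>, using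
  \<open>4 \<le> r\<close> and \<open>8 \<le> r ^ 2\<close>. \<open>J\<close> will be
  \<open>max 1 j\<close>, which gives no lower bound for \<open>j\<close>; where
  \<open>j ^ r\<close> stands on the larger side, the assumption on \<open>j\<close> supplies
  \<open>1 \<le> r ^ 3 * j ^ r\<close> instead.\<close>

lemma large_solution_inequalities:
  fixes U h K J j :: real
  assumes r: "r \<ge> 5" and h: "h \<ge> 1" and J: "J \<ge> 1" and j: "j > 0" "1 \<le> 4 * (real r)\<^sup>2 * j ^ r"
    and K: "1 \<le> K" "K \<le> 2 * real r ^ 4 * J\<^sup>2"
    and U: "h * real r ^ 5 * J ^ r \<le> U"
  shows "4 * (real r)\<^sup>2 * h\<^sup>2 * K < U ^ r" (is ?a)
    and "1 \<le> 8 * K * U ^ r" (is ?one)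
    and "8 * K * (4 * (real r)\<^sup>2 * h\<^sup>2 * K) ^ 4 \<le> U ^ (3 * r)" (is ?b)
    and "(8 * K) ^ 2 * h ^ r < j ^ r * U ^ (r * (r - 4))" (is ?c)
proof -
  let ?R = "real r"
  have R: "?R \<ge> 5" using r by simp
  have Rp: "?R ^ k \<ge> 1" "h ^ k \<ge> 1" "J ^ k \<ge> 1" for k using R h J by (auto intro: one_le_power)
  have K1: "K \<le> ?R ^ 5 * J\<^sup>2"
  proof -
    have "2 * (?R ^ 4 * J\<^sup>2) \<le> ?R * (?R ^ 4 * J\<^sup>2)" using R by (intro mult_right_mono) auto
    also have "\<dots> = ?R ^ 5 * J\<^sup>2" by (simp add: power_numeral_reduce mult_ac)
    finally show ?thesis using K by (simp add: mult_ac)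
  qed
  have U1: "h * ?R ^ 5 * J \<le> U"
  proof -
    have "J ^ 1 \<le> J ^ r" using J r by (intro power_increasing) auto
    then have "h * ?R ^ 5 * J \<le> h * ?R ^ 5 * J ^ r" using h by (intro mult_left_mono) auto
    then show ?thesis using U by linarith
  qed
  have Uge1: "U \<ge> 1"
  proof -
    have "1 * 1 * 1 \<le> h * ?R ^ 5 * J" using h J Rp by (intro mult_mono) auto
    then show ?thesis using U1 by simp
  qed
  show ?one
  proof -
    have "1 * 1 \<le> (8 * K) * U ^ r" using K Uge1 by (intro mult_mono one_le_power) auto
    then show ?thesis by simp
  qed
  have L: "4 * ?R\<^sup>2 * h\<^sup>2 * K \<le> ?R ^ 8 * h\<^sup>2 * J\<^sup>2"
  proof -
    have "4 * (?R\<^sup>2 * h\<^sup>2) * K \<le> ?R * (?R\<^sup>2 * h\<^sup>2) * (?R ^ 5 * J\<^sup>2)"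
      using R K K1 by (intro mult_mono) auto
    also have "\<dots> = ?R ^ 8 * h\<^sup>2 * J\<^sup>2" by (simp add: power_numeral_reduce mult_ac)
    finally show ?thesis by (simp add: mult_ac)
  qed
  have le: "?R ^ a * h ^ b * J ^ c \<le> ?R ^ a' * h ^ b' * J ^ c'" if "a \<le> a'" "b \<le> b'" "c \<le> c'" for a b c a' b' c'
    using that R h J by (intro mult_mono power_increasing) auto
  show ?a
  proof -
    have "?R ^ 8 < ?R ^ 25" using R by (intro power_strict_increasing) auto
    then have "?R ^ 8 * h\<^sup>2 * J\<^sup>2 < ?R ^ 25 * h\<^sup>2 * J\<^sup>2" using h J by (intro mult_strict_right_mono) auto
    also have "\<dots> \<le> ?R ^ 25 * h ^ 5 * J ^ 5" by (rule le) auto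
    also have "\<dots> = (h * ?R ^ 5 * J) ^ 5" by (simp add: power_mult_distrib mult_ac flip: power_mult)
    also have "\<dots> \<le> U ^ 5" using U1 h J by (intro power_mono) auto
    also have "\<dots> \<le> U ^ r" using Uge1 r by (intro power_increasing) auto
    finally show ?thesis using L by linarith
  qed
  have K8: "8 * K \<le> ?R ^ 7 * J\<^sup>2"
  proof -
    have "8 \<le> ?R ^ 2" using power_mono[of 5 ?R 2] R by simp
    then have "8 * K \<le> ?R ^ 2 * (?R ^ 5 * J\<^sup>2)" using K K1 by (intro mult_mono) auto
    then show ?thesis by (simp add: power_numeral_reduce mult_ac)
  qed
  show ?b
  proof -
    have "8 * K * (4 * ?R\<^sup>2 * h\<^sup>2 * K) ^ 4 \<le> (?R ^ 7 * J\<^sup>2) * (?R ^ 8 * h\<^sup>2 * J\<^sup>2) ^ 4"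
      by (rule mult_mono[OF K8 power_mono[OF L]]) (use K in auto)
    also have "\<dots> = ?R ^ 39 * h ^ 8 * J ^ 10"
    proof -
      have "(7::nat) + 8 * 4 = 39" "(2::nat) + 2 * 4 = 10" "(2::nat) * 4 = 8" by auto
      then show ?thesis
        by (simp only: power_mult_distrib power_mult[symmetric]) (simp add: mult_ac flip: power_add)
    qed
    also have "\<dots> \<le> ?R ^ 75 * h ^ 15 * J ^ 15" by (rule le) auto
    also have "\<dots> = (h * ?R ^ 5 * J) ^ 15" by (simp add: power_mult_distrib mult_ac flip: power_mult)
    also have "\<dots> \<le> U ^ 15" using U1 h J by (intro power_mono) auto
    also have "\<dots> \<le> U ^ (3 * r)" using Uge1 r by (intro power_increasing) auto
    finally show ?thesis .
  qed
  show ?c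
  proof -
    have jr: "1 \<le> ?R ^ 3 * j ^ r"
    proof -
      have "4 * ?R\<^sup>2 * j ^ r \<le> ?R * ?R\<^sup>2 * j ^ r" using R j by (intro mult_right_mono) auto
      then show ?thesis using j(2) by (simp add: power_numeral_reduce)
    qed
    have "(8 * K) ^ 2 * h ^ r \<le> (?R ^ 7 * J\<^sup>2) ^ 2 * h ^ r" using K8 K h by (intro mult_right_mono power_mono) auto
    also have "\<dots> = ?R ^ 14 * h ^ r * J ^ 4" by (simp add: power_mult_distrib mult_ac flip: power_mult)
    also have "\<dots> < ?R ^ 22 * h ^ r * J ^ 4"
      using R h J by (intro mult_strict_right_mono power_strict_increasing) auto
    also have "\<dots> \<le> ?R ^ 22 * h ^ r * J ^ 4 * (?R ^ 3 * j ^ r)"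
      using mult_left_mono[OF jr, of "?R ^ 22 * h ^ r * J ^ 4"] h J by simp
    also have "\<dots> = j ^ r * (?R ^ 25 * h ^ r * J ^ 4)"
    proof -
      have "?R ^ 22 * ?R ^ 3 = ?R ^ 25" by (simp flip: power_add)
      then show ?thesis by (metis mult.assoc mult.commute)
    qed
    also have "\<dots> \<le> j ^ r * (?R ^ (5 * r) * h ^ r * J ^ (r * r))"
    proof -
      have "1 * 4 \<le> r * r" using r by (intro mult_mono) auto
      then show ?thesis using j r by (intro mult_left_mono le) auto
    qed
    also have "\<dots> = j ^ r * (h * ?R ^ 5 * J ^ r) ^ r" by (simp add: power_mult_distrib mult_ac flip: power_mult)
    also have "\<dots> \<le> j ^ r * U ^ r" using U h J j by (intro mult_left_mono power_mono) auto
    also have "\<dots> \<le> j ^ r * U ^ (r * (r - 4))"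
    proof -
      have "r * 1 \<le> r * (r - 4)" using r by (intro mult_left_mono) auto
      then show ?thesis using j Uge1 by (intro mult_left_mono power_increasing) auto
    qed
    finally show ?thesis .
  qed
qed

section \<open>Diagonal forms\<close>

text \<open>The last assumption holds for forms over the integers because the left-hand side is the Jacobian
  of \<open>F\<close> and the quadratic form \<open>(A, B, C)\<close>.\<close>

locale diagonal_form =
  fixes r :: nat and \<alpha> \<beta> \<gamma> \<delta> \<kappa> :: complex and A B C :: int
    and F :: "int \<times> int \<Rightarrow> int"
  assumes r_ge_5: "r \<ge> 5"
    and det_neq_0: "\<alpha> * \<delta> - \<beta> * \<gamma> \<noteq> 0"
    and prod_A: "\<alpha> * \<gamma> = \<kappa> * of_int A"
    and prod_B: "\<alpha> * \<delta> + \<beta> * \<gamma> = \<kappa> * of_int B"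
    and prod_C: "\<beta> * \<delta> = \<kappa> * of_int C"
    and gcd_1: "gcd A (gcd B C) = 1"
    and F_eq: "\<And>x y. of_int (F (x, y)) = (\<alpha> * of_int x + \<beta> * of_int y) ^ r - (\<gamma> * of_int x + \<delta> * of_int y) ^ r"
    and theta_int: "\<And>x y. \<exists>z. of_nat r * ((\<alpha> * \<delta> - \<beta> * \<gamma>) / \<kappa>) *
       ((\<alpha> * of_int x + \<beta> * of_int y) ^ r + (\<gamma> * of_int x + \<delta> * of_int y) ^ r) = of_int z"
begin

section \<open>Identities for the linear forms at integer points\<close>

definition u :: "int \<times> int \<Rightarrow> complex" where
  "u p = \<alpha> * of_int (fst p) + \<beta> * of_int (snd p)"

definition v :: "int \<times> int \<Rightarrow> complex" where
  "v p = \<gamma> * of_int (fst p) + \<delta> * of_int (snd p)"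

definition j :: complex where "j = \<alpha> * \<delta> - \<beta> * \<gamma>"

definition D :: int where "D = B\<^sup>2 - 4 * A * C"

definition s :: complex where "s = j / \<kappa>"

definition Q :: "int \<times> int \<Rightarrow> int" where
  "Q p = A * (fst p)\<^sup>2 + B * fst p * snd p + C * (snd p)\<^sup>2"

definition det2 :: "int \<times> int \<Rightarrow> int \<times> int \<Rightarrow> int" where
  "det2 p q = fst p * snd q - snd p * fst q"

text \<open>The symmetric bilinear form of \<open>Q\<close>, normalized by
  \<open>polar p p = 2 * Q p\<close>.\<close>

definition polar :: "int \<times> int \<Rightarrow> int \<times> int \<Rightarrow> int" where
  "polar p q = 2 * A * fst p * fst q + B * (fst p * snd q + snd p * fst q) + 2 * C * snd p * snd q"

lemma j_neq_0: "j \<noteq> 0" using det_neq_0 by (simp add: j_def)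

lemma j_sq: "j\<^sup>2 = \<kappa>\<^sup>2 * of_int D"
proof -
  have "j\<^sup>2 = (\<alpha> * \<delta> + \<beta> * \<gamma>)\<^sup>2 - 4 * (\<alpha> * \<gamma>) * (\<beta> * \<delta>)"
    by (simp add: j_def power2_eq_square algebra_simps)
  then show ?thesis unfolding prod_A prod_B prod_C D_def
    by (simp add: power2_eq_square algebra_simps)
qed

lemma chi_neq_0: "\<kappa> \<noteq> 0" using j_sq j_neq_0 by auto

lemma D_neq_0: "D \<noteq> 0" using j_sq j_neq_0 by auto

lemma s_sq: "s\<^sup>2 = of_int D"
  using j_sq chi_neq_0 by (simp add: s_def power_divide)

lemma chi_s: "\<kappa> * s = j" using chi_neq_0 by (simp add: s_def)

lemma F_uv: "of_int (F p) = u p ^ r - v p ^ r"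
  using F_eq[of "fst p" "snd p"] by (simp add: u_def v_def)

lemma theta: "\<exists>z. of_nat r * s * (u p ^ r + v p ^ r) = of_int z"
  using theta_int[of "fst p" "snd p"] by (simp add: u_def v_def s_def j_def)

lemma u_times_v: "u p * v p = \<kappa> * of_int (Q p)"
proof -
  have "u p * v p = (\<alpha> * \<gamma>) * of_int (fst p) ^ 2 + (\<alpha> * \<delta> + \<beta> * \<gamma>) * of_int (fst p) * of_int (snd p)
     + (\<beta> * \<delta>) * of_int (snd p) ^ 2"
    by (simp add: u_def v_def power2_eq_square algebra_simps)
  then show ?thesis unfolding prod_A prod_B prod_C by (simp add: Q_def algebra_simps)
qed

lemma cross_diff: "u p * v q - v p * u q = j * of_int (det2 p q)"
  by (simp add: u_def v_def j_def det2_def algebra_simps)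

lemma cross_sum: "u p * v q + v p * u q = \<kappa> * of_int (polar p q)"
proof -
  have "u p * v q + v p * u q = 2 * (\<alpha> * \<gamma>) * of_int (fst p) * of_int (fst q) +
    (\<alpha> * \<delta> + \<beta> * \<gamma>) * (of_int (fst p) * of_int (snd q) + of_int (snd p) * of_int (fst q)) +
    2 * (\<beta> * \<delta>) * of_int (snd p) * of_int (snd q)"
    by (simp add: u_def v_def algebra_simps)
  then show ?thesis unfolding prod_A prod_B prod_C by (simp add: polar_def algebra_simps)
qed

lemma norm_s_ge_1: "norm s \<ge> 1"
proof -
  have "norm s ^ 2 = \<bar>of_int D\<bar>" by (metis norm_of_int norm_power s_sq)
  also have "\<dots> \<ge> (1 :: real)" using D_neq_0 by linarith
  finally show ?thesis by (metis norm_ge_zero one_power2 power2_le_imp_le)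
qed

text \<open>\<open>k * Q p ^ r\<close> is an integer for every \<open>p\<close>, and the values of a primitive form at \<open>(1, 0)\<close>, \<open>(0, 1)\<close>
  and \<open>(1, 1)\<close> have greatest common divisor 1.\<close>

lemma kappa_integral:
  "\<exists>z. 4 * of_nat r ^ 2 * of_int D * \<kappa> ^ r = (of_int z :: complex)"
proof -
  define k :: complex where "k = 4 * of_nat r ^ 2 * of_int D * \<kappa> ^ r"
  have k: "\<exists>z. k * of_int (Q p) ^ r = of_int z" for p
  proof -
    obtain z where z: "of_nat r * s * (u p ^ r + v p ^ r) = of_int z" using theta by blast
    \<comment> \<open>Squaring the integer \<open>z\<close> and subtracting
      \<open>r ^ 2 * D * F p ^ 2\<close> leaves \<open>4 * r ^ 2 * D * (u p * v p) ^ r\<close>,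
      which is \<open>k * Q p ^ r\<close>.\<close>
    have "(u p ^ r + v p ^ r)\<^sup>2 = (u p ^ r - v p ^ r)\<^sup>2 + 4 * (u p * v p) ^ r"
      by (simp add: power2_eq_square algebra_simps power_mult_distrib)
    then have "4 * (\<kappa> * of_int (Q p)) ^ r = (u p ^ r + v p ^ r)\<^sup>2 - (u p ^ r - v p ^ r)\<^sup>2"
      unfolding u_times_v by simp
    moreover have "k * of_int (Q p) ^ r = of_nat r ^ 2 * s\<^sup>2 * (4 * (\<kappa> * of_int (Q p)) ^ r)"
      by (simp add: k_def s_sq power_mult_distrib mult_ac)
    moreover have "n ^ 2 * t\<^sup>2 * (a\<^sup>2 - b\<^sup>2) = (n * t * a)\<^sup>2 - n ^ 2 * t\<^sup>2 * b\<^sup>2" for n t a b :: complex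
      by (simp add: algebra_simps power_mult_distrib)
    ultimately have "k * of_int (Q p) ^ r = (of_nat r * s * (u p ^ r + v p ^ r))\<^sup>2 - of_nat r ^ 2 * s\<^sup>2 * (u p ^ r - v p ^ r)\<^sup>2"
      by simp
    also have "\<dots> = of_int (z\<^sup>2 - int r ^ 2 * D * (F p)\<^sup>2)"
      unfolding z s_sq F_uv[symmetric] by simp
    finally show ?thesis by blast
  qed
  obtain a where a: "k * of_int A ^ r = of_int a" using k[of "(1, 0)"] by (auto simp: Q_def)
  obtain c where c: "k * of_int C ^ r = of_int c" using k[of "(0, 1)"] by (auto simp: Q_def)
  obtain e where e: "k * of_int (A + B + C) ^ r = of_int e" using k[of "(1, 1)"] by (auto simp: Q_def)
  have "gcd A (gcd C (A + B + C)) = 1"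
  proof -
    have "gcd A (gcd C (A + B + C)) dvd gcd A (gcd B C)"
    proof -
      let ?g = "gcd A (gcd C (A + B + C))"
      have d: "?g dvd A" "?g dvd C" "?g dvd A + B + C" by (meson dvd_trans gcd_dvd1 gcd_dvd2)+
      then have "?g dvd (A + B + C) - A - C" by (intro dvd_diff)
      then have "?g dvd B" by simp
      then show ?thesis using d by simp
    qed
    then show ?thesis using gcd_1 by (simp add: zdvd1_eq)
  qed
  then have "gcd (A ^ r) (gcd C (A + B + C) ^ r) = 1"
    by (metis coprime_iff_gcd_eq_1 coprime_power_left_iff coprime_power_right_iff)
  then obtain x y where xy: "x * A ^ r + y * gcd C (A + B + C) ^ r = 1" by (metis bezout_int)
  have "gcd (C ^ r) ((A + B + C) ^ r) = gcd C (A + B + C) ^ r"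
    by (simp add: gcd_exp)
  then obtain l m where lm: "l * C ^ r + m * (A + B + C) ^ r = gcd C (A + B + C) ^ r" by (metis bezout_int)
  have "x * A ^ r + y * (l * C ^ r + m * (A + B + C) ^ r) = 1" using xy lm by simp
  then have "of_int (x * A ^ r + y * (l * C ^ r + m * (A + B + C) ^ r)) = (1 :: complex)" by simp
  then have "of_int x * of_int A ^ r + of_int y * (of_int l * of_int C ^ r + of_int m * of_int (A + B + C) ^ r) = (1 :: complex)"
    by (simp only: of_int_add of_int_mult of_int_power)
  then have "k * (of_int x * of_int A ^ r + of_int y * (of_int l * of_int C ^ r + of_int m * of_int (A + B + C) ^ r)) = k"
    by (simp only: mult_1_right)
  then have "k = of_int x * (k * of_int A ^ r) + of_int y * (of_int l * (k * of_int C ^ r) + of_int m * (k * of_int (A + B + C) ^ r))"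
    by (simp only: distrib_left mult_ac)
  also have "\<dots> = of_int (x * a + y * (l * c + m * e))" unfolding a c e by simp
  finally show ?thesis unfolding k_def by blast
qed

text \<open>The nonzero integer of \<open>kappa_integral\<close> has modulus at least 1.
  Multiplication by \<open>norm s ^ r\<close> turns \<kappa> into \<open>j\<close>, because
  \<open>j\<close> is the product of \<kappa> and \<open>s\<close>.\<close>

lemma norm_s_power_le: "norm s ^ (r - 2) \<le> 4 * (real r)\<^sup>2 * norm j ^ r"
proof -
  obtain z where z: "4 * of_nat r ^ 2 * of_int D * \<kappa> ^ r = (of_int z :: complex)" using kappa_integral by blast
  then have "z \<noteq> 0" using chi_neq_0 D_neq_0 r_ge_5 by auto
  then have "1 \<le> norm (of_int z :: complex)" by simp
  also have "\<dots> = 4 * (real r)\<^sup>2 * norm s ^ 2 * norm \<kappa> ^ r"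
    unfolding z[symmetric] s_sq[symmetric] by (simp add: norm_mult norm_power)
  finally have "norm s ^ r * 1 \<le> norm s ^ r * (4 * (real r)\<^sup>2 * norm s ^ 2 * norm \<kappa> ^ r)"
    by (intro mult_left_mono) auto
  also have "\<dots> = norm s ^ 2 * (4 * (real r)\<^sup>2 * norm j ^ r)"
    unfolding chi_s[symmetric] by (simp add: norm_mult power_mult_distrib)
  also have "norm s ^ r * 1 = norm s ^ 2 * norm s ^ (r - 2)"
  proof -
    have "2 + (r - 2) = r" using r_ge_5 by simp
    then show ?thesis by (metis power_add mult_1_right)
  qed
  finally have "norm s ^ 2 * norm s ^ (r - 2) \<le> norm s ^ 2 * (4 * (real r)\<^sup>2 * norm j ^ r)" .
  then show ?thesis by (rule mult_left_le_imp_le) (use norm_s_ge_1 in \<open>auto intro!: zero_less_power\<close>)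
qed

lemma one_le_norm_j_power: "1 \<le> 4 * (real r)\<^sup>2 * norm j ^ r"
  using norm_s_power_le one_le_power[OF norm_s_ge_1, of "r - 2"] by linarith

text \<open>Makes the denominators \<open>2 * r * s\<close> controllable by \<open>r\<close> and
  \<open>j\<close> alone. A larger \<open>s\<close> would violate \<open>norm_s_power_le\<close>,
  because \<open>r ^ (r - 2)\<close> is at least \<open>r ^ 3\<close>, more than
  \<open>4 * r ^ 2\<close>, and \<open>2 * (r - 2) \<ge> r\<close>.\<close>

lemma norm_s_le: "norm s \<le> real r * (max 1 (norm j))\<^sup>2"
proof (rule ccontr)
  let ?J = "max 1 (norm j)" and ?R = "real r"
  assume "\<not> ?thesis"
  then have "(?R * ?J\<^sup>2) ^ (r - 2) \<le> norm s ^ (r - 2)" by (intro power_mono) auto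
  also have "\<dots> \<le> 4 * ?R\<^sup>2 * norm j ^ r" by (rule norm_s_power_le)
  also have "\<dots> \<le> 4 * ?R\<^sup>2 * ?J ^ r" by (intro mult_left_mono power_mono) auto
  also have "\<dots> < ?R * ?R\<^sup>2 * ?J ^ r"
    using r_ge_5 by (intro mult_strict_right_mono) (auto intro!: zero_less_power)
  also have "\<dots> = ?R ^ 3 * ?J ^ r" by (simp add: power_numeral_reduce)
  also have "\<dots> \<le> ?R ^ (r - 2) * ?J ^ (2 * (r - 2))"
    using r_ge_5 by (intro mult_mono power_increasing) auto
  also have "\<dots> = (?R * ?J\<^sup>2) ^ (r - 2)" by (simp add: power_mult_distrib flip: power_mult)
  finally show False by simp
qed

text \<open>Conjugate elements of \<open>\<int>[s]\<close>; as a relation, this also makes sense if \<open>D\<close> is a square.\<close>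

definition s_conj :: "complex \<Rightarrow> complex \<Rightarrow> bool" where
  "s_conj X Y \<longleftrightarrow> (\<exists>a b :: int. X = of_int a + of_int b * s \<and> Y = of_int a - of_int b * s)"

lemma s_conjI:
  "X = of_int a + of_int b * s \<Longrightarrow> Y = of_int a - of_int b * s \<Longrightarrow> s_conj X Y"
  unfolding s_conj_def by blast

lemma s_conj_of_int: "s_conj (of_int a) (of_int a)"
  by (rule s_conjI[of _ a 0]) auto

lemma s_conj_sym: "s_conj X Y \<Longrightarrow> s_conj Y X"
  unfolding s_conj_def by (metis add_uminus_conv_diff diff_minus_eq_add mult_minus_left of_int_minus)

lemma s_conj_add:
  assumes "s_conj X Y" "s_conj X' Y'"
  shows "s_conj (X + X') (Y + Y')"
proof -
  obtain a b a' b' :: int where eqs: "X = of_int a + of_int b * s" "Y = of_int a - of_int b * s"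
    "X' = of_int a' + of_int b' * s" "Y' = of_int a' - of_int b' * s"
    using assms unfolding s_conj_def by blast
  show ?thesis unfolding eqs by (rule s_conjI[of _ "a + a'" "b + b'"]) (simp_all add: algebra_simps)
qed

lemma s_conj_mult:
  assumes "s_conj X Y" "s_conj X' Y'"
  shows "s_conj (X * X') (Y * Y')"
proof -
  obtain a b a' b' :: int where "X = of_int a + of_int b * s" "Y = of_int a - of_int b * s"
    "X' = of_int a' + of_int b' * s" "Y' = of_int a' - of_int b' * s"
    using assms unfolding s_conj_def by blast
  moreover have "(x + y * s) * (x' + y' * s) = (x * x' + y * y' * s\<^sup>2) + (x * y' + y * x') * s"
    "(x - y * s) * (x' - y' * s) = (x * x' + y * y' * s\<^sup>2) - (x * y' + y * x') * s" for x y x' y'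
    by (simp_all add: algebra_simps power2_eq_square)
  ultimately show ?thesis
    by (intro s_conjI[of _ "a * a' + b * b' * D" "a * b' + b * a'"]) (simp_all add: s_sq)
qed

lemma s_conj_power:
  assumes "s_conj X Y"
  shows "s_conj (X ^ n) (Y ^ n)"
  using s_conj_of_int[of 1] by (induction n) (auto intro: s_conj_mult assms)

lemma s_conj_sum:
  assumes "\<And>i. i \<in> I \<Longrightarrow> s_conj (f i) (g i)"
  shows "s_conj (sum f I) (sum g I)"
  using assms
proof (induction I rule: infinite_finite_induct)
  case (insert x I)
  then show ?case by (simp add: s_conj_add)
qed (use s_conj_of_int[of 0] in auto)

text \<open>\<open>theta\<close> gives the sum of the two powers up to the factor
  \<open>r * s\<close>, and \<open>F p\<close> is their difference. Solving for each power
  introduces the factor 2.\<close>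

lemma s_conj_uv: "s_conj (2 * of_nat r * s * u p ^ r) (2 * of_nat r * s * v p ^ r)"
proof -
  obtain z where z: "of_nat r * s * (u p ^ r + v p ^ r) = of_int z" using theta by blast
  have "2 * of_nat r * s * u p ^ r = of_nat r * s * (u p ^ r + v p ^ r) + of_nat r * s * (u p ^ r - v p ^ r)"
    "2 * of_nat r * s * v p ^ r = of_nat r * s * (u p ^ r + v p ^ r) - of_nat r * s * (u p ^ r - v p ^ r)"
    by (simp_all add: algebra_simps)
  then show ?thesis unfolding z F_uv[symmetric]
    by (intro s_conjI[of _ z "int r * F p"]) (simp_all add: mult_ac)
qed

text \<open>Homogenized approximants: exchanging the arguments exchanges numerator and denominator,
  so conjugate arguments give conjugate values.\<close>

definition pade_form :: "nat \<Rightarrow> complex \<Rightarrow> complex \<Rightarrow> complex" where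
  "pade_form n X Y = (\<Sum>k\<le>n. of_real (pade_coeff r n k) * (X ^ (n - k) * Y ^ k))"

text \<open>\<open>(2 * r * s) ^ n\<close> is spread over the \<open>n\<close> factors of each
  monomial, and \<open>r ^ (2 * n)\<close> clears the denominators of the binomial
  coefficients.\<close>

lemma s_conj_pade_form:
  "s_conj ((2 * of_nat r * s) ^ n * of_nat r ^ (2 * n) * pade_form n (u p ^ r) (v p ^ r))
    ((2 * of_nat r * s) ^ n * of_nat r ^ (2 * n) * pade_form n (v p ^ r) (u p ^ r))"
proof -
  have "\<exists>z. \<forall>k\<le>n. real r ^ (2 * n) * pade_coeff r n k = of_int (z k)"
    using pade_coeff_integral[of r _ n] r_ge_5 by (intro choice) auto
  then obtain z where z: "\<And>k. k \<le> n \<Longrightarrow> real r ^ (2 * n) * pade_coeff r n k = of_int (z k)" by blast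
  have eq: "(2 * of_nat r * s) ^ n * of_nat r ^ (2 * n) * pade_form n X Y =
     (\<Sum>k\<le>n. of_int (z k) * ((2 * of_nat r * s * X) ^ (n - k) * (2 * of_nat r * s * Y) ^ k))" for X Y
    unfolding pade_form_def sum_distrib_left
  proof (rule sum.cong)
    fix k assume "k \<in> {..n}"
    then have k: "k \<le> n" by simp
    let ?t = "2 * of_nat r * s"
    have "of_int (z k) = complex_of_real (real r ^ (2 * n) * pade_coeff r n k)" unfolding z[OF k] by simp
    then have zk: "of_int (z k) = of_nat r ^ (2 * n) * complex_of_real (pade_coeff r n k)" by simp
    have "?t ^ n = ?t ^ (n - k) * ?t ^ k" using k by (simp flip: power_add)
    then show "?t ^ n * of_nat r ^ (2 * n) * (of_real (pade_coeff r n k) * (X ^ (n - k) * Y ^ k)) =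
      of_int (z k) * ((?t * X) ^ (n - k) * (?t * Y) ^ k)"
      unfolding zk by (simp only: power_mult_distrib mult_ac)
  qed simp
  show ?thesis unfolding eq
    by (intro s_conj_sum s_conj_mult s_conj_of_int s_conj_power s_conj_uv s_conj_sym[OF s_conj_uv])
qed


text \<open>Here \<open>\<omega>\<close> will be the root of unity for which \<open>\<omega> * v p / u p\<close> is the principal \<open>r\<close>-th root of \<open>(v p / u p) ^ r\<close>.\<close>

definition near :: "complex \<Rightarrow> real \<Rightarrow> int \<times> int \<Rightarrow> bool" where
  "near \<omega> h p \<longleftrightarrow> u p \<noteq> 0 \<and> norm (\<omega> * v p / u p - 1) \<le> h / (2 * norm (u p) ^ r)"

text \<open>With the same \<omega> at both points, \<open>\<omega> * v / u\<close> is close to 1 at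
  each of them, while the two values differ by
  \<open>\<omega> * j * det2 p q / (u p * u q)\<close>.\<close>

lemma gap_principle:
  assumes "near \<omega> h p" "near \<omega> h q" "norm \<omega> = 1" "h > 0"
    and "norm (u p) \<le> norm (u q)" "det2 p q \<noteq> 0"
  shows "norm j * norm (u p) ^ (r - 1) \<le> h * norm (u q)"
proof -
  let ?U = "norm (u p)" and ?V = "norm (u q)"
  let ?wp = "\<omega> * v p / u p" and ?wq = "\<omega> * v q / u q"
  have nz: "u p \<noteq> 0" "u q \<noteq> 0" using assms by (auto simp: near_def)
  have Ur: "?U ^ r = ?U * ?U ^ (r - 1)" using r_ge_5 by (simp flip: power_Suc)
  have "\<omega> * (j * of_int (det2 p q)) = u p * u q * ((?wq - 1) - (?wp - 1))"
    unfolding cross_diff[symmetric] using nz by (simp add: field_simps)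
  then have "norm j * norm (of_int (det2 p q) :: complex) = ?U * ?V * norm ((?wq - 1) - (?wp - 1))"
    using assms(3) by (metis norm_mult mult_1_left)
  moreover have "norm j * 1 \<le> norm j * norm (of_int (det2 p q) :: complex)"
    using assms(6) by (intro mult_left_mono) auto
  ultimately have "norm j \<le> ?U * ?V * norm ((?wq - 1) - (?wp - 1))" by simp
  also have "\<dots> \<le> ?U * ?V * (h / (2 * ?V ^ r) + h / (2 * ?U ^ r))"
  proof (rule mult_left_mono)
    have "norm (?wp - 1) \<le> h / (2 * ?U ^ r)" "norm (?wq - 1) \<le> h / (2 * ?V ^ r)"
      using assms(1,2) by (auto simp: near_def)
    then show "norm ((?wq - 1) - (?wp - 1)) \<le> h / (2 * ?V ^ r) + h / (2 * ?U ^ r)"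
      using norm_triangle_ineq4[of "?wq - 1" "?wp - 1"] by linarith
  qed simp
  also have "\<dots> \<le> ?U * ?V * (h / (2 * ?U ^ r) + h / (2 * ?U ^ r))"
    using assms(4,5) nz by (intro mult_left_mono add_mono divide_left_mono power_mono mult_pos_pos) auto
  also have "\<dots> = h * ?V / ?U ^ (r - 1)" unfolding Ur using nz by (simp add: field_simps)
  finally show ?thesis using nz by (simp add: field_simps)
qed

text \<open>With conjugate coefficients \<open>a + b * s\<close> and \<open>a - b * s\<close>, the
  expression is \<open>a\<close> times the cross difference plus \<open>b * s\<close> times the
  cross sum. Both are integer multiples of \<open>j\<close>, since \<kappa> times \<open>s\<close>
  is \<open>j\<close>.\<close>

lemma Lambda_lower_bound:
  fixes p q n
  defines "L \<equiv> u p * pade_form n (u p ^ r) (v p ^ r) * v q - v p * pade_form n (v p ^ r) (u p ^ r) * u q"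
  assumes "L \<noteq> 0"
  shows "norm j \<le> (2 * real r ^ 3 * norm s) ^ n * norm L"
proof -
  let ?t = "(2 * of_nat r * s) ^ n * of_nat r ^ (2 * n) :: complex"
  obtain a b :: int where ab: "?t * pade_form n (u p ^ r) (v p ^ r) = of_int a + of_int b * s"
     "?t * pade_form n (v p ^ r) (u p ^ r) = of_int a - of_int b * s"
    using s_conj_pade_form unfolding s_conj_def by blast
  have t0: "?t \<noteq> 0" using r_ge_5 norm_s_ge_1 by auto
  have "?t * L = u p * (?t * pade_form n (u p ^ r) (v p ^ r)) * v q - v p * (?t * pade_form n (v p ^ r) (u p ^ r)) * u q"
    unfolding L_def by (simp add: algebra_simps)
  also have "\<dots> = of_int a * (u p * v q - v p * u q) + of_int b * s * (u p * v q + v p * u q)"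
    unfolding ab by (simp add: algebra_simps)
  also have "\<dots> = j * of_int (a * det2 p q + b * polar p q)"
    unfolding cross_diff cross_sum chi_s[symmetric] by (simp add: algebra_simps)
  finally have tL: "?t * L = j * of_int (a * det2 p q + b * polar p q)" .
  then have "a * det2 p q + b * polar p q \<noteq> 0" using assms(2) t0 by (metis mult_eq_0_iff of_int_0)
  then have "1 \<le> \<bar>real_of_int (a * det2 p q + b * polar p q)\<bar>" by linarith
  then have "norm j * 1 \<le> norm j * norm (of_int (a * det2 p q + b * polar p q) :: complex)"
    by (intro mult_left_mono) (simp_all only: norm_of_int norm_ge_zero)
  also have "\<dots> = norm ?t * norm L" using arg_cong[OF tL, of norm] by (simp only: norm_mult)
  also have "norm ?t = (2 * real r ^ 3 * norm s) ^ n"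
  proof -
    have "norm ?t = (2 * real r * norm s) ^ n * ((real r)\<^sup>2) ^ n"
      by (simp add: norm_mult norm_power power_mult)
    also have "\<dots> = (2 * real r ^ 3 * norm s) ^ n"
      by (simp only: power_mult_distrib[symmetric]) (simp add: power2_eq_square power3_eq_cube mult_ac)
    finally show ?thesis .
  qed
  finally show ?thesis by simp
qed

lemma pade_form_eq:
  assumes "X \<noteq> 0"
  shows "pade_form n X Y = X ^ n * pade_num r n (Y / X)"
    and "pade_form n Y X = X ^ n * pade_den r n (Y / X)"
proof -
  show "pade_form n X Y = X ^ n * pade_num r n (Y / X)"
    unfolding pade_form_def pade_num_def sum_distrib_left
  proof (rule sum.cong)
    fix k assume "k \<in> {..n}"
    then have "X ^ n = X ^ (n - k) * X ^ k" by (simp flip: power_add)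
    then show "of_real (pade_coeff r n k) * (X ^ (n - k) * Y ^ k) = X ^ n * (of_real (pade_coeff r n k) * (Y / X) ^ k)"
      using assms by (simp add: power_divide)
  qed simp
  show "pade_form n Y X = X ^ n * pade_den r n (Y / X)"
    unfolding pade_form_def pade_den_def sum_distrib_left
  proof (rule sum.cong)
    fix k assume "k \<in> {..n}"
    then have "X ^ n = X ^ (n - k) * X ^ k" by (simp flip: power_add)
    then show "of_real (pade_coeff r n k) * (Y ^ (n - k) * X ^ k) = X ^ n * (of_real (pade_coeff r n k) * (Y / X) ^ (n - k))"
      using assms by (simp add: power_divide)
  qed simp
qed

lemma Lambda_eq:
  assumes "u p \<noteq> 0" "u q \<noteq> 0" "\<omega> \<noteq> 0"
  shows "\<omega> * (u p * pade_form n (u p ^ r) (v p ^ r) * v q - v p * pade_form n (v p ^ r) (u p ^ r) * u q) =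
    u p ^ (r * n + 1) * u q *
      (pade_num r n (v p ^ r / u p ^ r) * (\<omega> * v q / u q) - \<omega> * v p / u p * pade_den r n (v p ^ r / u p ^ r))"
proof -
  have "\<omega> * (a * (Z * P) * d - b * (Z * N) * c) = Z * a * c * (P * (\<omega> * d / c) - \<omega> * b / a * N)"
    if "a \<noteq> 0" "c \<noteq> 0" for a b c d Z P N :: complex
    using that by (simp add: field_simps)
  moreover have "u p ^ (r * n + 1) = (u p ^ r) ^ n * u p" by (simp add: power_mult)
  ultimately show ?thesis using assms by (simp only: pade_form_eq power_not_zero not_False_eq_True)
qed

lemma hypergeometric_contradiction:
  assumes near: "near \<omega> h p" "near \<omega> h q" and \<omega>: "\<omega> ^ r = 1" "norm \<omega> = 1" and h: "h \<ge> 1"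
    and le: "norm (u p) \<le> norm (u q)" and det: "det2 p q \<noteq> 0"
    and F0: "F p \<noteq> 0" "v q \<noteq> 0" "v p \<noteq> 0"
    and large: "h * real r ^ 5 * (max 1 (norm j)) ^ r \<le> norm (u p)"
  shows False
proof -
  let ?U = "norm (u p)" and ?V = "norm (u q)" and ?J = "max 1 (norm j)" and ?R = "real r"
  let ?wp = "\<omega> * v p / u p" and ?wq = "\<omega> * v q / u q" and ?x = "v p ^ r / u p ^ r"
  define K where "K = 2 * ?R ^ 3 * norm s"
  have R5: "?R \<ge> 5" using r_ge_5 by simp
  have nz: "u p \<noteq> 0" "u q \<noteq> 0" "\<omega> \<noteq> 0" using near \<omega> by (auto simp: near_def)
  have x: "?wp ^ r = ?x" using \<omega>(1) by (simp add: power_divide power_mult_distrib)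
  have K: "1 \<le> K" "K \<le> 2 * ?R ^ 4 * ?J\<^sup>2"
  proof -
    have "1 * 1 * 1 \<le> 2 * ?R ^ 3 * norm s" using R5 norm_s_ge_1 by (intro mult_mono one_le_power) auto
    then show "1 \<le> K" by (simp add: K_def)
    have "2 * ?R ^ 3 * norm s \<le> 2 * ?R ^ 3 * (?R * ?J\<^sup>2)" by (intro mult_left_mono norm_s_le) auto
    then show "K \<le> 2 * ?R ^ 4 * ?J\<^sup>2" by (simp add: K_def power_numeral_reduce mult_ac)
  qed
  have j: "norm j > 0" using j_neq_0 by simp
  note ineqs = large_solution_inequalities[OF r_ge_5 h _ j one_le_norm_j_power K large]
  have "\<exists>n. \<forall>N\<in>{n, Suc n}. (8 * K * ?U ^ r) ^ N * ?U * h * ?V < norm j * ?V ^ r \<and>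
     (4 * ?R\<^sup>2 * h\<^sup>2 * K / ?U ^ r) ^ N * ?U * h * ?V \<le> norm j * ?U ^ r"
    by (rule exists_small_index[OF _ _ _ _ j r_ge_5 ineqs])
      (use nz h K gap_principle[OF near \<omega>(2) _ le det] in auto)
  then obtain n where n: "\<And>N. N \<in> {n, Suc n} \<Longrightarrow> (8 * K * ?U ^ r) ^ N * ?U * h * ?V < norm j * ?V ^ r"
     "\<And>N. N \<in> {n, Suc n} \<Longrightarrow> (4 * ?R\<^sup>2 * h\<^sup>2 * K / ?U ^ r) ^ N * ?U * h * ?V \<le> norm j * ?U ^ r"
    by blast
  define L where "L N = u p * pade_form N (u p ^ r) (v p ^ r) * v q - v p * pade_form N (v p ^ r) (u p ^ r) * u q" for N
  have Leq: "\<omega> * L N = u p ^ (r * N + 1) * u q * (pade_num r N ?x * ?wq - ?wp * pade_den r N ?x)" for N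
    unfolding L_def by (rule Lambda_eq[OF nz])
  \<comment> \<open>If both vanished, eliminating \<open>?wp\<close> and \<open>?wq\<close> would
    make the determinant of two consecutive approximants zero at \<open>?x\<close>; and
    \<open>?x\<close> is not 1 because \<open>F p \<noteq> 0\<close>.\<close>
  have "\<exists>N\<in>{n, Suc n}. L N \<noteq> 0"
  proof (rule ccontr)
    assume "\<not> ?thesis"
    then have "L n = 0" "L (Suc n) = 0" by auto
    then have e: "pade_num r n ?x * ?wq = ?wp * pade_den r n ?x"
       "pade_num r (Suc n) ?x * ?wq = ?wp * pade_den r (Suc n) ?x"
      using Leq[of n] Leq[of "Suc n"] nz by auto
    have "?wq \<noteq> 0" "?wp \<noteq> 0" using F0 nz by auto
    have "(pade_num r n ?x * ?wq) * (?wp * pade_den r (Suc n) ?x) = (?wp * pade_den r n ?x) * (pade_num r (Suc n) ?x * ?wq)"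
      unfolding e ..
    then have "(?wq * ?wp) * (pade_num r n ?x * pade_den r (Suc n) ?x) = (?wq * ?wp) * (pade_num r (Suc n) ?x * pade_den r n ?x)"
      by (simp only: mult_ac)
    then have "pade_num r n ?x * pade_den r (Suc n) ?x = pade_num r (Suc n) ?x * pade_den r n ?x"
      using \<open>?wq \<noteq> 0\<close> \<open>?wp \<noteq> 0\<close> by (simp only: mult_cancel_left) simp
    moreover have "?x \<noteq> 1"
    proof
      assume "?x = 1"
      then have "v p ^ r = u p ^ r" using nz by simp
      then have "of_int (F p) = (0 :: complex)" unfolding F_uv by simp
      then show False using F0(1) by simp
    qed
    ultimately show False using pade_det_neq_0[of r ?x n] r_ge_5 by simp
  qed
  then obtain N where N: "N \<in> {n, Suc n}" "L N \<noteq> 0" by blast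
  define e where "e = h / (2 * ?U ^ r)"
  have wp: "norm (?wp - 1) \<le> e" and wq: "norm (?wq - 1) \<le> h / (2 * ?V ^ r)"
    using near by (auto simp: near_def e_def)
  have Up: "?U ^ r > 0" "?V ^ r > 0" using nz by auto
  have e4: "4 * ?R * e \<le> 1"
  proof -
    have "2 * ?R * h \<le> 4 * ?R\<^sup>2 * h\<^sup>2 * K"
    proof -
      have "2 * (?R * h) * 1 \<le> 4 * (?R\<^sup>2 * h\<^sup>2) * K"
        using R5 h K by (intro mult_mono self_le_power) auto
      then show ?thesis by (simp add: mult_ac)
    qed
    then have "2 * ?R * h \<le> ?U ^ r" using ineqs(1) by linarith
    then show ?thesis using Up by (simp add: e_def field_simps)
  qed
  have w4: "4 * ?R * norm (?wp - 1) \<le> 1"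
    using e4 mult_left_mono[OF wp, of "4 * ?R"] by simp
  have "norm ?x \<le> 2"
  proof -
    have "norm (?x - 1) \<le> 2 * ?R * norm (?wp - 1)" unfolding x[symmetric] by (rule norm_power_minus_1_le[OF order_refl w4])
    then show ?thesis using w4 norm_triangle_ineq[of "?x - 1" 1] by simp
  qed
  have num: "norm (pade_num r N ?x) \<le> 8 ^ N" by (rule norm_pade_num_le) (use r_ge_5 \<open>norm ?x \<le> 2\<close> in auto)
  have err: "norm (pade_num r N ?x - ?wp * pade_den r N ?x) \<le> e * (4 * ?R\<^sup>2 * h\<^sup>2 / (?U ^ r)\<^sup>2) ^ N"
  proof -
    have "norm (pade_num r N ?x - ?wp * pade_den r N ?x) \<le> norm (?wp - 1) * (16 * ?R\<^sup>2 * (norm (?wp - 1))\<^sup>2) ^ N"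
      using pade_error[OF _ w4, of N] r_ge_5 unfolding x by simp
    also have "\<dots> \<le> e * (16 * ?R\<^sup>2 * e\<^sup>2) ^ N"
      using wp by (intro mult_mono power_mono) (auto intro: order_trans[OF norm_ge_zero wp])
    also have "16 * ?R\<^sup>2 * e\<^sup>2 = 4 * ?R\<^sup>2 * h\<^sup>2 / (?U ^ r)\<^sup>2"
      by (simp add: e_def power_divide power_mult_distrib)
    finally show ?thesis .
  qed
  have "norm (L N) = ?U ^ (r * N + 1) * ?V * norm (pade_num r N ?x * ?wq - ?wp * pade_den r N ?x)"
    using arg_cong[OF Leq[of N], of norm] \<omega>(2) by (simp only: norm_mult norm_power mult_1_left)
  \<comment> \<open>The nearness of \<open>q\<close> controls the first summand, the approximation
    at \<open>p\<close> the second.\<close>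
  also have "pade_num r N ?x * ?wq - ?wp * pade_den r N ?x =
      pade_num r N ?x * (?wq - 1) + (pade_num r N ?x - ?wp * pade_den r N ?x)" by (simp only: algebra_simps mult_1_left mult_1_right)
  also have "norm \<dots> \<le> 8 ^ N * (h / (2 * ?V ^ r)) + e * (4 * ?R\<^sup>2 * h\<^sup>2 / (?U ^ r)\<^sup>2) ^ N"
  proof -
    have "norm (pade_num r N ?x * (?wq - 1)) \<le> 8 ^ N * (h / (2 * ?V ^ r))"
      unfolding norm_mult by (intro mult_mono num wq) auto
    then show ?thesis by (intro order_trans[OF norm_triangle_ineq] add_mono err)
  qed
  finally have LN: "norm (L N) \<le> ?U ^ (r * N + 1) * ?V * (8 ^ N * (h / (2 * ?V ^ r)) + e * (4 * ?R\<^sup>2 * h\<^sup>2 / (?U ^ r)\<^sup>2) ^ N)"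
    using nz by (simp add: mult_left_mono)
  have "norm j \<le> K ^ N * norm (L N)"
    unfolding K_def L_def by (rule Lambda_lower_bound) (use N(2) in \<open>simp add: L_def\<close>)
  also have "\<dots> \<le> K ^ N * (?U ^ (r * N + 1) * ?V * (8 ^ N * (h / (2 * ?V ^ r)) + e * (4 * ?R\<^sup>2 * h\<^sup>2 / (?U ^ r)\<^sup>2) ^ N))"
    using LN K by (intro mult_left_mono) auto
  also have "\<dots> = ((8 * K * ?U ^ r) ^ N * ?U * h * ?V) / (2 * ?V ^ r) +
       ((4 * ?R\<^sup>2 * h\<^sup>2 * K / ?U ^ r) ^ N * ?U * h * ?V) / (2 * ?U ^ r)"
  proof -
    have g: "k ^ N * ((a ^ N * b) * c * (8 ^ N * (d / (2 * f)) + d / (2 * a) * (m / a\<^sup>2) ^ N)) =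
        ((8 * k * a) ^ N * b * d * c) / (2 * f) + ((m * k / a) ^ N * b * d * c) / (2 * a)"
      if "a > 0" for k a b c d f m :: real
    proof -
      have eq: "(m * k / a) = k * a * (m / a\<^sup>2)" using that by (simp add: power2_eq_square)
      have "k ^ N * ((a ^ N * b) * c * (8 ^ N * (d / (2 * f)) + d / (2 * a) * Y ^ N)) =
        ((8 * k * a) ^ N * b * d * c) / (2 * f) + ((k * a * Y) ^ N * b * d * c) / (2 * a)" for Y
        by (simp add: power_mult_distrib algebra_simps)
      then show ?thesis unfolding eq .
    qed
    have "?U ^ (r * N + 1) = (?U ^ r) ^ N * ?U" by (simp add: power_mult)
    then show ?thesis unfolding e_def by (simp only: g[OF Up(1)])
  qed
  \<comment> \<open>The two inequalities defining \<open>n\<close> bound each summand by half of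
    \<open>norm j\<close>, the first one strictly.\<close>
  also have "\<dots> < (norm j * ?V ^ r) / (2 * ?V ^ r) + (norm j * ?U ^ r) / (2 * ?U ^ r)"
    using n(1)[OF N(1)] n(2)[OF N(1)] Up by (intro add_less_le_mono divide_strict_right_mono divide_right_mono) auto
  also have "\<dots> = norm j" using nz by simp
  finally show False by simp
qed

end

section \<open>The threshold for the Hessian\<close>

text \<open>The root is the principal branch. On the disc of radius 3/5 the modulus is at least 2/5,
  so the derivative of the root is at most (5/2)/r, hence at most 1/2; this halving accounts for the
  2 in \<open>near\<close>.\<close>

lemma root_near_1:
  fixes x :: complex
  assumes "norm (x - 1) \<le> 3 / 5" "r \<ge> 5"
  shows "\<exists>w. w ^ r = x \<and> norm (w - 1) \<le> norm (x - 1) / 2 \<and> (x \<in> \<real> \<longrightarrow> w \<in> \<real>)"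
proof (intro exI conjI impI)
  let ?f = "\<lambda>y. exp (Ln y / of_nat r)"
  let ?B = "cball (1 :: complex) (norm (x - 1))"
  have Re: "Re y \<ge> 2 / 5" if "y \<in> ?B" for y
  proof -
    have "norm (1 - y) \<le> 3 / 5" using that assms(1) by (simp add: dist_norm)
    then show ?thesis using complex_Re_le_cmod[of "1 - y"] by simp
  qed
  have xB: "x \<in> ?B" by (simp add: dist_norm norm_minus_commute)
  then have "x \<noteq> 0" using Re[of x] by auto
  then show "?f x ^ r = x" using assms(2) by (simp flip: exp_of_nat_mult)
  have "norm (?f x - ?f 1) \<le> 1 / 2 * norm (x - 1)"
  proof (rule field_differentiable_bound)
    show "convex ?B" by simp
    show "(?f has_field_derivative ?f y * (1 / y / of_nat r)) (at y within ?B)" if "y \<in> ?B" for y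
    proof -
      have "y \<notin> \<real>\<^sub>\<le>\<^sub>0" using Re[OF that] by (auto simp: complex_nonpos_Reals_iff)
      moreover from this have "y \<noteq> 0" by auto
      ultimately show ?thesis using assms(2) by (auto intro!: derivative_eq_intros simp: field_simps)
    qed
    show "norm (?f y * (1 / y / of_nat r)) \<le> 1 / 2" if "y \<in> ?B" for y
    proof -
      have y: "norm y \<ge> 2 / 5" using Re[OF that] complex_Re_le_cmod[of y] by linarith
      then have "y \<noteq> 0" by auto
      have "norm (?f y) = exp (ln (norm y) / real r)"
        using \<open>y \<noteq> 0\<close> by (simp add: norm_exp_eq_Re)
      also have "\<dots> \<le> max 1 (norm y)"
      proof (cases "norm y \<le> 1")
        case True
        then have "ln (norm y) / real r \<le> 0" using \<open>y \<noteq> 0\<close> by (simp add: divide_nonpos_nonneg)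
        then have "exp (ln (norm y) / real r) \<le> 1" by simp
        then show ?thesis by (rule max.coboundedI1)
      next
        case False
        then have "ln (norm y) / real r \<le> ln (norm y) / 1"
          using assms(2) by (intro divide_left_mono) auto
        then have "exp (ln (norm y) / real r) \<le> exp (ln (norm y))" by simp
        also have "\<dots> = norm y" using \<open>y \<noteq> 0\<close> by simp
        finally show ?thesis by simp
      qed
      finally have "norm (?f y) \<le> max 1 (norm y)" .
      moreover have "max 1 (norm y) \<le> 5 / 2 * norm y" using y by auto
      ultimately have "norm (?f y) \<le> 5 / 2 * norm y" by linarith
      then have "norm (?f y) / norm y \<le> (5 / 2 * norm y) / norm y" by (rule divide_right_mono) simp
      also have "\<dots> = 5 / 2" using \<open>y \<noteq> 0\<close> by simp
      finally have "norm (?f y) / norm y \<le> 5 / 2" .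
      have "norm (?f y) / norm y / real r \<le> 5 / 2 / 5"
        by (rule frac_le) (use assms(2) \<open>norm (?f y) / norm y \<le> 5 / 2\<close> in simp_all)
      then show ?thesis by (simp add: norm_mult norm_divide)
    qed
  qed (use xB in auto)
  then show "norm (?f x - 1) \<le> norm (x - 1) / 2" by simp
  assume "x \<in> \<real>"
  then obtain t where t: "x = of_real t" by (auto simp: Reals_def)
  then have "t > 0" using Re[OF xB] by simp
  then have "?f x = of_real (exp (ln t / real r))"
    unfolding t by (simp add: Ln_of_real flip: exp_of_real)
  then show "?f x \<in> \<real>" by simp
qed

text \<open>\<open>G\<close> is the geometric mean of \<open>U ^ r\<close> and \<open>V ^ r\<close>;
  were \<open>U ^ r\<close> below \<open>G - h\<close>, then \<open>V ^ r\<close> would be at most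
  \<open>G\<close> and the product too small. Since \<open>h\<close> is at most 3/8 of
  \<open>G\<close>, the constant 8/3 drops to 5/3, the reciprocal of the radius 3/5 needed for the
  root.\<close>

lemma large_linear_factor:
  fixes U V h E :: real
  assumes "U \<ge> 0" "V \<ge> 0" "\<bar>U ^ r - V ^ r\<bar> \<le> h" "(8 / 3 * h * E)\<^sup>2 \<le> (U * V) ^ (r - 2)"
    and "h \<ge> 1" "E \<ge> 1" "r \<ge> 5"
  shows "U ^ r \<ge> 5 / 3 * h" "U ^ (r - 2) \<ge> 5 / 3 * h * E"
proof -
  let ?P = "U * V" and ?X = "U ^ r"
  define G where "G = sqrt (?X * V ^ r)"
  have "h * 1 \<le> h * E" using assms by (intro mult_left_mono) auto
  then have hE: "h * E \<ge> h" "h * E \<ge> 1" using assms(5) by linarith+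
  have "1 < (8 / 3 * h * E)\<^sup>2" using hE by (intro one_less_power) auto
  then have P: "?P ^ (r - 2) > 1" using assms by linarith
  have P1: "?P \<ge> 1"
  proof (rule ccontr)
    assume "\<not> ?thesis"
    then have "?P ^ (r - 2) \<le> 1" using assms by (intro power_le_one) auto
    then show False using P by simp
  qed
  have rr: "(r - 2) + 2 = r" using assms by simp
  have r2: "?P ^ r = ?P ^ (r - 2) * ?P\<^sup>2" using power_add[of ?P "r - 2" 2] unfolding rr .
  have G2: "G\<^sup>2 = ?P ^ r" using assms by (simp add: G_def power_mult_distrib)
  have "?P ^ (r - 2) * 1 \<le> ?P ^ (r - 2) * ?P\<^sup>2" using P P1 by (intro mult_left_mono one_le_power) linarith+
  then have "(8 / 3 * h * E)\<^sup>2 \<le> G\<^sup>2" using assms(4) unfolding G2 r2 by linarith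
  moreover have "G \<ge> 0" using assms(1,2) by (simp add: G_def)
  ultimately have "8 / 3 * h * E \<le> G" by (rule power2_le_imp_le)
  then have G: "8 / 3 * (h * E) \<le> G" by (simp only: mult.assoc)
  then have G0: "G > 0" using hE by linarith
  have X: "?X \<ge> G - h"
  proof (rule ccontr)
    assume "\<not> ?thesis"
    then have a: "?X < G - h" by simp
    then have b: "V ^ r \<le> G" using assms(3) by linarith
    have "G * G = ?X * V ^ r" using assms by (simp add: G_def)
    also have "\<dots> \<le> ?X * G" using b assms by (intro mult_left_mono) auto
    also have "\<dots> < G * G" using a assms(5) G0 by (intro mult_strict_right_mono) auto
    finally show False by simp
  qed
  then have X': "?X \<ge> 5 / 8 * G" using G hE by linarith
  then show "?X \<ge> 5 / 3 * h" using G hE by linarith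
  \<comment> \<open>Either \<open>U ^ 2\<close> is at least \<open>U * V\<close>, and its power
    suffices, or \<open>U ^ 4\<close> is at most \<open>(U * V) ^ 2\<close> and can be split off
    from the squared bound for \<open>U ^ r\<close>.\<close>
  have "(5 / 3 * h * E)\<^sup>2 \<le> (U ^ (r - 2))\<^sup>2"
  proof (cases "U\<^sup>2 \<ge> ?P")
    case True
    have "(5 / 3 * h * E)\<^sup>2 \<le> (8 / 3 * h * E)\<^sup>2" using assms by (intro power_mono mult_right_mono) auto
    also have "\<dots> \<le> ?P ^ (r - 2)" by fact
    also have "\<dots> \<le> (U\<^sup>2) ^ (r - 2)" using True assms by (intro power_mono) auto
    also have "\<dots> = (U ^ (r - 2))\<^sup>2" by (simp add: mult.commute flip: power_mult)
    finally show ?thesis .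
  next
    case False
    have "(5 / 8 * G)\<^sup>2 = 25 / 64 * G\<^sup>2" by (simp add: power2_eq_square)
    then have "25 / 64 * ?P ^ (r - 2) * ?P\<^sup>2 = (5 / 8 * G)\<^sup>2"
      unfolding G2 r2 by (simp only: mult.assoc)
    also have "\<dots> \<le> ?X\<^sup>2" using X' G0 by (intro power_mono) auto
    also have "\<dots> = (U ^ (r - 2))\<^sup>2 * (U\<^sup>2)\<^sup>2"
    proof -
      have "?X = U ^ (r - 2) * U\<^sup>2" using power_add[of U "r - 2" 2] unfolding rr .
      then show ?thesis by (simp add: power_mult_distrib)
    qed
    also have "\<dots> \<le> (U ^ (r - 2))\<^sup>2 * ?P\<^sup>2" using False by (intro mult_left_mono power_mono) auto
    finally have "25 / 64 * ?P ^ (r - 2) \<le> (U ^ (r - 2))\<^sup>2"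
      by (rule mult_right_le_imp_le) (use P1 in \<open>intro zero_less_power, linarith\<close>)
    moreover have "(5 / 3 * h * E)\<^sup>2 = 25 / 64 * (8 / 3 * h * E)\<^sup>2" by (simp add: power2_eq_square)
    ultimately show ?thesis using assms(4) by linarith
  qed
  then show "U ^ (r - 2) \<ge> 5 / 3 * h * E" by (rule power2_le_imp_le) (use assms in auto)
qed

text \<open>\<open>E\<close> is the part of \<open>H_L\<close> that depends on \<open>m\<close>; the last inequality says that after \<open>m - 1\<close> gaps
  it has grown enough for the hypergeometric method.\<close>

lemma H_L_threshold:
  fixes J :: real
  assumes r: "r \<ge> 5" and h: "h > 0" and m: "m \<ge> 3" and J: "J > 0"
  obtains E where "E \<ge> 1"
    and "\<And>P. H_L r h m J \<le> (real r)\<^sup>2 * (real r - 1)\<^sup>2 * J\<^sup>2 * P \<Longrightarrow> (8 / 3 * real h * E)\<^sup>2 \<le> P"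
    and "J * (real h * real r ^ 5 * max 1 J ^ r) ^ (r - 2) \<le> real h * (E * J) ^ ((r - 1) ^ (m - 1))"
proof -
  let ?R = "real r" and ?h = "real h"
  define M where "M = (?R - 1) ^ (m - 1)"
  define N where "N = (r - 1) ^ (m - 1)"
  have MN: "M = real N" using r by (simp add: M_def N_def of_nat_diff)
  have N2: "(r - 1)\<^sup>2 \<le> N" unfolding N_def using r m by (intro power_increasing) auto
  have N1: "1 \<le> N" using r by (simp add: N_def)
  have M: "M \<ge> 1" using N1 MN by simp
  have R: "?R \<ge> 5" and h1: "?h \<ge> 1" using r h by auto
  \<comment> \<open>\<open>a\<close>, \<open>b\<close> and \<open>c\<close> are the square roots of
    what remains of the three powers in \<open>H_L\<close> after \<open>r ^ 5\<close>,
    \<open>h ^ 2\<close> and \<open>J ^ 2\<close> are split off. For \<open>J < 1\<close> the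
    exponent of \<open>c\<close> is not positive, so \<open>c \<ge> 1\<close> in both cases.\<close>
  define c where "c = J powr ((i6 r m J - 2) / 2)"
  define a where "a = ?R powr ((11 * ?R - 3) / (2 * M))"
  define b where "b = ?h powr ((?R - 3) / M)"
  define E where "E = a * b * c"
  have a1: "a \<ge> 1" unfolding a_def using R M by (intro ge_one_powr_ge_zero) auto
  have b1: "b \<ge> 1" unfolding b_def using R M h1 by (intro ge_one_powr_ge_zero) auto
  have i6_lt: "i6 r m J = 2 / ((?R - 3) * M)" if "\<not> J \<ge> 1"
    unfolding i6_def M_def using that by simp
  have c1: "c \<ge> 1"
  proof (cases "J \<ge> 1")
    case True
    then show ?thesis by (simp add: c_def i6_def J)
  next
    case False
    have "1 * 1 \<le> (?R - 3) * M" using R M by (intro mult_mono) auto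
    then have "2 / ((?R - 3) * M) \<le> 2 / 1" by (intro divide_left_mono) auto
    then have "i6 r m J \<le> 2" unfolding i6_lt[OF False] by simp
    moreover have "ln J \<le> 0" using False J by simp
    ultimately have "0 \<le> (i6 r m J - 2) / 2 * ln J" by (intro mult_nonpos_nonpos) auto
    then show ?thesis using J by (simp add: c_def powr_def)
  qed
  have "1 * 1 * 1 \<le> a * b * c" using a1 b1 c1 by (intro mult_mono) auto
  then have E1: "E \<ge> 1" by (simp add: E_def)
  have sq: "(x powr y)\<^sup>2 = x powr (2 * y)" for x y :: real
    by (simp add: power2_eq_square flip: powr_add)
  have HL: "H_L r h m J = ?R ^ 5 * ?h\<^sup>2 * J\<^sup>2 * E\<^sup>2"
  proof -
    have t: "2 * (z / (2 * M)) = z / M" "2 * (z / 2) = z" for z :: real by simp_all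
    have "?R powr i4 r m = ?R ^ 5 * a\<^sup>2"
      unfolding i4_def a_def sq t M_def[symmetric] powr_add using R M by (simp add: powr_realpow)
    moreover have "?h powr i5 r m = ?h\<^sup>2 * b\<^sup>2"
      unfolding i5_def b_def sq M_def[symmetric] powr_add using h1 M by (simp add: powr_realpow)
    moreover have "J powr i6 r m J = J\<^sup>2 * c\<^sup>2"
    proof -
      have "J powr i6 r m J = J powr (2 + (i6 r m J - 2))" by simp
      also have "\<dots> = J\<^sup>2 * c\<^sup>2" unfolding c_def sq t powr_add using J by (simp add: powr_realpow)
      finally show ?thesis .
    qed
    ultimately show ?thesis unfolding H_L_def E_def by (simp add: power_mult_distrib mult_ac)
  qed
  show ?thesis
  proof (rule that[OF E1])
    fix P assume "H_L r h m J \<le> ?R\<^sup>2 * (?R - 1)\<^sup>2 * J\<^sup>2 * P"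
    then have "(?R\<^sup>2 * J\<^sup>2) * (?R ^ 3 * (?h * E)\<^sup>2) \<le> (?R\<^sup>2 * J\<^sup>2) * ((?R - 1)\<^sup>2 * P)"
      unfolding HL by (simp add: power_mult_distrib power_numeral_reduce mult_ac)
    then have 1: "?R ^ 3 * (?h * E)\<^sup>2 \<le> (?R - 1)\<^sup>2 * P" using R J by simp
    \<comment> \<open>Tight at \<open>r = 5\<close>, where 125 meets about 113.8; this is what
      permits the constant 8/3. From \<open>r = 8\<close> on, 64/9 is below
      \<open>r\<close>.\<close>
    have "64 / 9 * (?R - 1)\<^sup>2 \<le> ?R ^ 3"
    proof -
      consider "r = 5" | "r = 6" | "r = 7" | "r \<ge> 8" using r by linarith
      then show ?thesis
      proof cases
        case 4
        then have "64 / 9 * (?R - 1)\<^sup>2 \<le> ?R * ?R\<^sup>2" by (intro mult_mono power_mono) auto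
        then show ?thesis by (simp add: power_numeral_reduce)
      qed (auto simp: power2_eq_square power3_eq_cube)
    qed
    then have "64 / 9 * (?R - 1)\<^sup>2 * (?h * E)\<^sup>2 \<le> ?R ^ 3 * (?h * E)\<^sup>2" by (intro mult_right_mono) auto
    then have "(?R - 1)\<^sup>2 * (8 / 3 * ?h * E)\<^sup>2 \<le> (?R - 1)\<^sup>2 * P"
      using 1 by (simp add: power_mult_distrib power_divide mult_ac)
    then show "(8 / 3 * ?h * E)\<^sup>2 \<le> P" using R by simp
  next
    have pw: "(x powr y) ^ N = x powr (y * M)" for x y :: real
      unfolding MN using N1 by (cases "x = 0") (auto simp: powr_power mult.commute)
    \<comment> \<open>The exponent \<open>(11 * r - 3) / 2\<close> exceeds
      \<open>5 * (r - 2)\<close>.\<close>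
    have "(?R ^ 5) ^ (r - 2) \<le> a ^ N"
    proof -
      have "(?R ^ 5) ^ (r - 2) = ?R powr (5 * (?R - 2))"
      proof -
        have "(?R ^ 5) ^ (r - 2) = ?R ^ (5 * (r - 2))" by (simp only: power_mult)
        also have "\<dots> = ?R powr real (5 * (r - 2))" using R by (subst powr_realpow) auto
        also have "real (5 * (r - 2)) = 5 * (?R - 2)" using r by (simp add: of_nat_diff)
        finally show ?thesis .
      qed
      also have "\<dots> \<le> ?R powr ((11 * ?R - 3) / (2 * M) * M)"
        using R M by (intro powr_mono) (auto simp: field_simps)
      also have "\<dots> = a ^ N" unfolding a_def pw ..
      finally show ?thesis .
    qed
    moreover have "?h ^ (r - 2) = ?h * b ^ N"
    proof -
      have "b ^ N = ?h powr real (r - 3)" unfolding b_def pw using M r by (simp add: of_nat_diff)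
      also have "\<dots> = ?h ^ (r - 3)" using h by (simp add: powr_realpow)
      finally have "?h * b ^ N = ?h ^ Suc (r - 3)" by simp
      also have "Suc (r - 3) = r - 2" using r by simp
      finally show ?thesis by simp
    qed
    \<comment> \<open>For \<open>J \<ge> 1\<close> the required exponent
      \<open>1 + r * (r - 2)\<close> is \<open>(r - 1) ^ 2\<close>, at most \<open>N\<close> because
      \<open>m \<ge> 3\<close>. For \<open>J < 1\<close> the right side is
      \<open>J powr (1 / (r - 3))\<close>, which is what \<open>i6\<close> is made for.\<close>
    moreover have "J * (max 1 J ^ r) ^ (r - 2) \<le> (c * J) ^ N"
    proof (cases "J \<ge> 1")
      case True
      have "Suc (r * (r - 2)) = (r - 1)\<^sup>2"
      proof -
        obtain k where "r = k + 2" using r by (intro that[of "r - 2"]) simp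
        then show ?thesis by (simp add: power2_eq_square algebra_simps)
      qed
      then have "J * (J ^ r) ^ (r - 2) = J ^ ((r - 1)\<^sup>2)" by (metis power_Suc power_mult)
      also have "\<dots> \<le> J ^ N" using True N2 by (intro power_increasing) auto
      finally show ?thesis using True J by (simp add: c_def i6_def)
    next
      case False
      then have J1: "J < 1" by simp
      have "c * J = J powr ((i6 r m J - 2) / 2 + 1)" unfolding c_def powr_add using J by simp
      also have "(i6 r m J - 2) / 2 + 1 = 1 / ((?R - 3) * M)"
        unfolding i6_lt[OF False] by (simp add: diff_divide_distrib)
      finally have "(c * J) ^ N = J powr (1 / ((?R - 3) * M) * M)" by (simp only: pw)
      also have "\<dots> = J powr (1 / (?R - 3))" using M by simp
      also have "\<dots> \<ge> J powr 1" using J J1 R by (intro powr_mono') auto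
      finally show ?thesis using J J1 by simp
    qed
    ultimately have "(?R ^ 5) ^ (r - 2) * ?h ^ (r - 2) * (J * (max 1 J ^ r) ^ (r - 2)) \<le> a ^ N * (?h * b ^ N) * (c * J) ^ N"
      using J a1 b1 by (intro mult_mono) auto
    then show "J * (?h * ?R ^ 5 * max 1 J ^ r) ^ (r - 2) \<le> ?h * (E * J) ^ ((r - 1) ^ (m - 1))"
      unfolding N_def[symmetric] E_def by (simp add: power_mult_distrib mult_ac)
  qed
qed

section \<open>Chains of gaps and counting up to sign\<close>

lemma gap_chain:
  fixes U W :: "'a \<Rightarrow> real"
  assumes "finite X" "card X = Suc k" "0 \<le> w" "\<And>p. p \<in> X \<Longrightarrow> w \<le> W p"
    and "\<And>p q. p \<in> X \<Longrightarrow> q \<in> X \<Longrightarrow> p \<noteq> q \<Longrightarrow> U p \<le> U q \<Longrightarrow> W p ^ e \<le> W q"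
    and "b \<in> X" "\<And>p. p \<in> X \<Longrightarrow> U p \<le> U b"
  shows "w ^ (e ^ k) \<le> W b"
  using assms
proof (induction k arbitrary: X b)
  case 0
  then show ?case by simp
next
  case (Suc k)
  \<comment> \<open>Without \<open>b\<close>, the chain ends at a largest remaining element
    \<open>b'\<close>; the gap from \<open>b'\<close> to \<open>b\<close> supplies the last exponent
    \<open>e\<close>.\<close>
  let ?Y = "X - {b}"
  have Y: "finite ?Y" "card ?Y = Suc k" using Suc.prems by auto
  then have "?Y \<noteq> {}" by (metis card.empty nat.distinct(1))
  then have "Max (U ` ?Y) \<in> U ` ?Y" using Y by (intro Max_in) auto
  then obtain b' where b': "b' \<in> ?Y" "U b' = Max (U ` ?Y)" by (metis imageE)
  have max: "U p \<le> U b'" if "p \<in> ?Y" for p unfolding b'(2) using Y that by (intro Max_ge) auto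
  have "w ^ (e ^ k) \<le> W b'" by (rule Suc.IH[OF Y Suc.prems(3) _ _ b'(1) max]) (use Suc.prems in auto)
  then have "(w ^ (e ^ k)) ^ e \<le> W b' ^ e" using Suc.prems(3) by (intro power_mono) auto
  also have "\<dots> \<le> W b" using Suc.prems b'(1) by auto
  finally show ?case by (simp add: mult.commute flip: power_mult)
qed

lemma coprime_parallel:
  fixes x y x' y' :: int
  assumes "coprime x y" "coprime x' y'" "x * y' = y * x'"
  shows "(x', y') = (x, y) \<or> (x', y') = (- x, - y)"
proof -
  have "x dvd x'" using assms(1,3) by (metis coprime_dvd_mult_right_iff dvd_triv_left)
  then obtain k where k: "x' = x * k" by blast
  have "y dvd y'" using assms(1,3) by (metis coprime_commute coprime_dvd_mult_right_iff dvd_triv_left)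
  then obtain l where l: "y' = y * l" by blast
  have "x' dvd x" using assms(2,3) by (metis coprime_dvd_mult_left_iff dvd_triv_right)
  have "y' dvd y" using assms(2,3) by (metis coprime_commute coprime_dvd_mult_left_iff dvd_triv_right)
  have "\<bar>x'\<bar> = \<bar>x\<bar>" "\<bar>y'\<bar> = \<bar>y\<bar>"
    using \<open>x dvd x'\<close> \<open>x' dvd x\<close> \<open>y dvd y'\<close> \<open>y' dvd y\<close> by (auto intro: zdvd_antisym_abs)
  then have c: "x' = x \<or> x' = - x" "y' = y \<or> y' = - y" by (auto simp: abs_eq_iff)
  have "x \<noteq> 0 \<or> y \<noteq> 0" using assms(1) by auto
  then show ?thesis using c assms(3) by auto
qed

text \<open>Replaces classes by representatives: primitive vectors from different classes are
  linearly independent. Choosing exactly \<open>n + 1\<close> classes also disposes of the case of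
  infinitely many.\<close>

lemma at_most_up_to_signI:
  assumes cop: "\<And>x y. (x, y) \<in> S \<Longrightarrow> coprime x y"
    and le: "\<And>X. X \<subseteq> S \<Longrightarrow> finite X \<Longrightarrow>
      (\<And>p q. p \<in> X \<Longrightarrow> q \<in> X \<Longrightarrow> p \<noteq> q \<Longrightarrow> fst p * snd q - snd p * fst q \<noteq> 0) \<Longrightarrow> card X \<le> n"
  shows "at_most_up_to_sign S n"
proof (rule ccontr)
  let ?c = "\<lambda>(x, y). {(x, y), (- x, - y)} :: (int \<times> int) set"
  assume "\<not> ?thesis"
  have "\<exists>T \<subseteq> up_to_sign S. finite T \<and> card T = Suc n"
  proof (cases "finite (up_to_sign S)")
    case True
    then have "Suc n \<le> card (up_to_sign S)"
      using \<open>\<not> at_most_up_to_sign S n\<close> by (simp add: at_most_up_to_sign_def)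
    then show ?thesis by (rule obtain_subset_with_card_n) blast
  next
    case False
    then show ?thesis using infinite_arbitrarily_large by blast
  qed
  then obtain T where T: "T \<subseteq> up_to_sign S" "finite T" "card T = Suc n" by blast
  then have "\<forall>t\<in>T. \<exists>p. p \<in> S \<and> ?c p = t" unfolding up_to_sign_def by blast
  from bchoice[OF this] obtain f where "\<forall>t\<in>T. f t \<in> S \<and> ?c (f t) = t" ..
  then have f: "f t \<in> S" "?c (f t) = t" if "t \<in> T" for t using that by simp_all
  have inj: "inj_on f T"
  proof (rule inj_onI)
    fix t t' assume "t \<in> T" "t' \<in> T" "f t = f t'"
    then have "?c (f t) = ?c (f t')" by simp
    then show "t = t'" using f(2) \<open>t \<in> T\<close> \<open>t' \<in> T\<close> by simp
  qed
  have "card (f ` T) \<le> n"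
  proof (rule le)
    show "f ` T \<subseteq> S" "finite (f ` T)" using f T by auto
    fix p q assume pq: "p \<in> f ` T" "q \<in> f ` T" "p \<noteq> q"
    then obtain t t' where t: "t \<in> T" "t' \<in> T" "p = f t" "q = f t'" by blast
    then have "t \<noteq> t'" using pq by auto
    then have ne: "?c p \<noteq> ?c q" using f(2) t by simp
    obtain x y x' y' where e: "p = (x, y)" "q = (x', y')" by (metis surj_pair)
    have "coprime x y" "coprime x' y'" using f(1) t e cop by metis+
    show "fst p * snd q - snd p * fst q \<noteq> 0"
    proof
      assume "fst p * snd q - snd p * fst q = 0"
      then have "x * y' = y * x'" by (simp add: e)
      from coprime_parallel[OF \<open>coprime x y\<close> \<open>coprime x' y'\<close> this] have "?c p = ?c q"
        by (auto simp: e)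
      then show False using ne by simp
    qed
  qed
  then show False using card_image[OF inj] T by simp
qed

section \<open>Counting solutions by classes\<close>

context diagonal_form
begin

text \<open>The reality condition for positive \<open>D\<close> makes \<omega> comparable between
  different points, since it leaves only real quotients of two such roots of unity.\<close>

definition in_class :: "complex \<Rightarrow> real \<Rightarrow> int \<times> int \<Rightarrow> bool" where
  "in_class \<omega> h p \<longleftrightarrow> \<omega> ^ r = 1 \<and> near \<omega> h p \<and> v p \<noteq> 0 \<and> (D > 0 \<longrightarrow> \<omega> * v p / u p \<in> \<real>)"

lemma s_Reals: "D > 0 \<Longrightarrow> s \<in> \<real>"
proof -
  assume "D > 0"
  then have "s\<^sup>2 = (of_real (sqrt (of_int D)))\<^sup>2"
    unfolding s_sq by (simp flip: of_real_power)
  then have "s = of_real (sqrt (of_int D)) \<or> s = - of_real (sqrt (of_int D))" by (simp only: power2_eq_iff)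
  then show "s \<in> \<real>" by auto
qed

lemma root_of_unity_norm:
  fixes \<omega> :: complex
  assumes "\<omega> ^ r = 1"
  shows "norm \<omega> = 1"
proof (rule power_eq_imp_eq_base)
  show "norm \<omega> ^ r = 1 ^ r" using arg_cong[OF assms, of norm] by (simp add: norm_power)
qed (use r_ge_5 in auto)

text \<open>\<open>(v p / u p) ^ r\<close> differs from 1 by \<open>F p / u p ^ r\<close> in
  modulus, at most 3/5. If \<open>w\<close> is its root near 1, then \<omega> is
  \<open>w * u p / v p\<close>. For \<open>D > 0\<close> the sum and the difference of
  \<open>u p ^ r\<close> and \<open>v p ^ r\<close> are real, hence so is their quotient, and the
  root inherits this.\<close>

lemma exists_class:
  assumes "F p \<noteq> 0" "\<bar>real_of_int (F p)\<bar> \<le> h" "h \<ge> 1" "norm (u p) ^ r \<ge> 5 / 3 * h"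
  shows "\<exists>\<omega>. in_class \<omega> h p"
proof -
  let ?X = "norm (u p) ^ r" and ?x = "(v p / u p) ^ r"
  have X: "?X > 0" using assms by linarith
  then have u0: "u p \<noteq> 0" using r_ge_5 by (auto simp: power_0_left)
  have "?x - 1 = - (of_int (F p) / u p ^ r)" unfolding F_uv using u0 by (simp add: power_divide field_simps)
  then have "norm (?x - 1) = \<bar>real_of_int (F p)\<bar> / ?X"
    by (simp add: norm_divide norm_power)
  then have x: "norm (?x - 1) \<le> h / ?X" using assms(2) X by (simp add: divide_right_mono)
  also have "\<dots> \<le> 3 / 5" using assms(4) X by (simp add: divide_le_eq)
  finally have x35: "norm (?x - 1) \<le> 3 / 5" .
  then obtain w where w: "w ^ r = ?x" "norm (w - 1) \<le> norm (?x - 1) / 2" "?x \<in> \<real> \<longrightarrow> w \<in> \<real>"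
    using root_near_1[OF _ r_ge_5] by blast
  have v0: "v p \<noteq> 0"
  proof
    assume "v p = 0"
    then have "?x = 0" using r_ge_5 by simp
    then show False using x35 by (simp only:) simp
  qed
  define \<omega> where "\<omega> = w * u p / v p"
  have wv: "\<omega> * v p / u p = w" using u0 v0 by (simp add: \<omega>_def)
  have "\<omega> ^ r = 1" using u0 v0 w(1) by (simp add: \<omega>_def power_mult_distrib power_divide)
  moreover have "near \<omega> h p"
  proof -
    have "norm (w - 1) \<le> h / ?X / 2" by (rule order_trans[OF w(2) divide_right_mono[OF x]]) simp
    then show ?thesis using u0 by (simp add: near_def wv mult.commute)
  qed
  moreover have "w \<in> \<real>" if "D > 0"
  proof -
    obtain z where z: "of_nat r * s * (u p ^ r + v p ^ r) = of_int z" using theta by blast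
    have "of_nat r * s \<noteq> 0" using r_ge_5 norm_s_ge_1 by auto
    then have sum: "u p ^ r + v p ^ r = of_int z / (of_nat r * s)" by (simp add: z[symmetric])
    have "u p ^ r + v p ^ r \<in> \<real>" unfolding sum using s_Reals[OF that] by (intro Reals_divide Reals_mult) auto
    moreover have "u p ^ r - v p ^ r \<in> \<real>" unfolding F_uv[symmetric] by simp
    ultimately have "(u p ^ r + v p ^ r) + (u p ^ r - v p ^ r) \<in> \<real>" "(u p ^ r + v p ^ r) - (u p ^ r - v p ^ r) \<in> \<real>"
      by (simp_all only: Reals_add Reals_diff)
    then have "(2 * v p ^ r) / (2 * u p ^ r) \<in> \<real>" by (intro Reals_divide) simp_all
    then show ?thesis using w(3) by (simp add: power_divide)
  qed
  ultimately have "in_class \<omega> h p" unfolding in_class_def wv using v0 by simp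
  then show ?thesis ..
qed

text \<open>The quotient of the two roots of unity is a quotient of two real numbers times a real
  cross ratio, hence real; having modulus 1, it is 1 or -1. For odd \<open>r\<close> the latter
  would send an \<open>r\<close>-th root of 1 to one of -1.\<close>

lemma class_unique_up_to_sign:
  assumes "in_class \<omega> h p" "in_class \<omega>' h q" "D > 0"
  shows "\<omega>' = \<omega> \<or> \<omega>' = - \<omega>" "odd r \<Longrightarrow> \<omega>' = \<omega>"
proof -
  have nz: "u p \<noteq> 0" "v p \<noteq> 0" "u q \<noteq> 0" "v q \<noteq> 0" and w: "\<omega> ^ r = 1" "\<omega>' ^ r = 1"
    "\<omega> * v p / u p \<in> \<real>" "\<omega>' * v q / u q \<in> \<real>"
    using assms by (auto simp: in_class_def near_def)
  have \<omega>0: "\<omega> \<noteq> 0" "\<omega>' \<noteq> 0" using w(1,2) r_ge_5 by (auto simp: power_0_left)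
  have "2 * (u q * v p) = (u p * v q + v p * u q) - (u p * v q - v p * u q)"
       "2 * (v q * u p) = (u p * v q + v p * u q) + (u p * v q - v p * u q)"
    by (simp_all add: algebra_simps)
  then have "2 * (u q * v p) = \<kappa> * (of_int (polar p q) - s * of_int (det2 p q))"
       "2 * (v q * u p) = \<kappa> * (of_int (polar p q) + s * of_int (det2 p q))"
    unfolding cross_sum cross_diff chi_s[symmetric] by (simp_all add: algebra_simps)
  then have "(2 * (u q * v p)) / (2 * (v q * u p)) = (of_int (polar p q) - s * of_int (det2 p q)) / (of_int (polar p q) + s * of_int (det2 p q))"
    using chi_neq_0 by simp
  moreover have "(of_int (polar p q) - s * of_int (det2 p q)) / (of_int (polar p q) + s * of_int (det2 p q)) \<in> \<real>"
    using s_Reals[OF assms(3)] by (intro Reals_divide Reals_diff Reals_add Reals_mult) auto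
  ultimately have "(u q * v p) / (v q * u p) \<in> \<real>" by simp
  then have "(\<omega>' * v q / u q) / (\<omega> * v p / u p) * ((u q * v p) / (v q * u p)) \<in> \<real>"
    by (rule Reals_mult[OF Reals_divide[OF w(4,3)]])
  moreover have "(\<omega>' * v q / u q) / (\<omega> * v p / u p) * ((u q * v p) / (v q * u p)) = \<omega>' / \<omega>"
    using nz \<omega>0 by (simp add: field_simps)
  ultimately have "\<omega>' / \<omega> \<in> \<real>" by simp
  then obtain t where t: "\<omega>' / \<omega> = of_real t" by (auto simp: Reals_def)
  have "norm (\<omega>' / \<omega>) = 1" using root_of_unity_norm w by (simp add: norm_divide)
  then have "\<bar>t\<bar> = 1" unfolding t by simp
  then have "t = 1 \<or> t = -1" by linarith
  then have "\<omega>' / \<omega> = 1 \<or> \<omega>' / \<omega> = -1" using t by auto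
  then show *: "\<omega>' = \<omega> \<or> \<omega>' = - \<omega>" using \<omega>0 by (auto simp: field_simps)
  show "\<omega>' = \<omega>" if "odd r"
  proof (rule ccontr)
    assume "\<omega>' \<noteq> \<omega>"
    then have "\<omega>' = - \<omega>" using * by blast
    then have "\<omega>' ^ r = - 1" using that w(1) by simp
    then show False using w(2) by simp
  qed
qed

lemma card_class_le:
  assumes X: "finite X" "\<And>p q. p \<in> X \<Longrightarrow> q \<in> X \<Longrightarrow> p \<noteq> q \<Longrightarrow> det2 p q \<noteq> 0"
    and cls: "\<And>p. p \<in> X \<Longrightarrow> in_class \<omega> h p" and F0: "\<And>p. p \<in> X \<Longrightarrow> F p \<noteq> 0"
    and big: "\<And>p. p \<in> X \<Longrightarrow> 5 / 3 * h * E \<le> norm (u p) ^ (r - 2)"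
    and h: "h \<ge> 1" and E: "E \<ge> 1" and m: "m \<ge> 3"
    and thr: "norm j * (h * real r ^ 5 * max 1 (norm j) ^ r) ^ (r - 2) \<le> h * (E * norm j) ^ ((r - 1) ^ (m - 1))"
  shows "card X \<le> m"
proof (rule ccontr)
  assume "\<not> ?thesis"
  then obtain Y where Y: "Y \<subseteq> X" "card Y = Suc m" "finite Y"
    by (metis not_less_eq_eq obtain_subset_with_card_n)
  have j: "norm j > 0" using j_neq_0 by simp
  define U where "U p = norm (u p)" for p
  \<comment> \<open>In this normalization the gap principle loses its constants and becomes
    \<open>W p ^ (r - 1) \<le> W q\<close>, which can be iterated.\<close>
  define W where "W p = U p ^ (r - 2) * norm j / h" for p
  have near: "near \<omega> h p" "norm \<omega> = 1" "\<omega> ^ r = 1" if "p \<in> X" for p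
    using cls[OF that] root_of_unity_norm by (auto simp: in_class_def)
  have gap: "norm j * U p ^ (r - 1) \<le> h * U q" if "p \<in> X" "q \<in> X" "p \<noteq> q" "U p \<le> U q" for p q
    using gap_principle[of \<omega> h p q] near X(2) that h by (auto simp: U_def)
  have gapW: "W p ^ (r - 1) \<le> W q" if pq: "p \<in> X" "q \<in> X" "p \<noteq> q" "U p \<le> U q" for p q
  proof -
    have r1: "r - 1 = Suc (r - 2)" using r_ge_5 by simp
    have "norm j * U p ^ (r - 1) / h \<le> U q" using gap[OF pq] h by (simp add: divide_le_eq mult.commute)
    then have "(norm j * U p ^ (r - 1) / h) ^ (r - 2) \<le> U q ^ (r - 2)"
      using h by (intro power_mono) (auto simp: U_def)
    then have "(norm j * U p ^ (r - 1) / h) ^ (r - 2) * norm j / h \<le> W q"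
      unfolding W_def using h by (intro divide_right_mono mult_right_mono) auto
    moreover have "(norm j * U p ^ (r - 1) / h) ^ (r - 2) * norm j / h = W p ^ (r - 1)"
      unfolding W_def r1 by (simp add: power_mult_distrib power_divide mult_ac flip: power_mult)
    ultimately show ?thesis by simp
  qed
  have Wge: "E * norm j \<le> W p" if "p \<in> X" for p
  proof -
    have "1 * (h * E) \<le> 5 / 3 * (h * E)" using h E by (intro mult_right_mono) auto
    then have "h * E \<le> 5 / 3 * h * E" by (simp only: mult_1_left mult.assoc)
    then have "h * E \<le> U p ^ (r - 2)" using big[OF that] unfolding U_def by linarith
    then have "(h * E) * norm j / h \<le> U p ^ (r - 2) * norm j / h" using h by (intro divide_right_mono mult_right_mono) auto
    then show ?thesis using h by (simp add: W_def)
  qed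
  have "\<exists>b\<in>Z. \<forall>p\<in>Z. U p \<le> U b" if "finite Z" "Z \<noteq> {}" for Z
  proof -
    have "Max (U ` Z) \<in> U ` Z" using that by (intro Max_in) auto
    then obtain b where "b \<in> Z" "U b = Max (U ` Z)" by (metis imageE)
    then show ?thesis using that by (intro bexI[of _ b]) auto
  qed
  note max = this
  have "Y \<noteq> {}" using Y by auto
  then obtain b where b: "b \<in> Y" "\<And>p. p \<in> Y \<Longrightarrow> U p \<le> U b" using max[OF Y(3)] by blast
  \<comment> \<open>Of the \<open>m + 1\<close> points, \<open>m\<close> remain below
    \<open>b\<close>, so \<open>m - 1\<close> gaps lead up to the second largest point
    \<open>p\<close>; the pair \<open>p\<close>, \<open>b\<close> is kept for the hypergeometric
    method.\<close>
  have Yb: "finite (Y - {b})" "card (Y - {b}) = Suc (m - 1)" using Y b(1) m by auto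
  then have "Y - {b} \<noteq> {}" by (metis card.empty nat.distinct(1))
  then obtain p where p: "p \<in> Y - {b}" "\<And>q. q \<in> Y - {b} \<Longrightarrow> U q \<le> U p" using max[OF Yb(1)] by blast
  have pX: "p \<in> X" "b \<in> X" "p \<noteq> b" using p(1) b(1) Y(1) by auto
  have "(E * norm j) ^ ((r - 1) ^ (m - 1)) \<le> W p"
  proof (rule gap_chain[OF Yb, where U = U])
    show "0 \<le> E * norm j" using E j by simp
    show "E * norm j \<le> W q" if "q \<in> Y - {b}" for q using Wge that Y(1) by blast
    show "W q ^ (r - 1) \<le> W q'" if "q \<in> Y - {b}" "q' \<in> Y - {b}" "q \<noteq> q'" "U q \<le> U q'" for q q'
      using gapW that Y(1) by blast
  qed (use p in blast)+
  then have "h * (E * norm j) ^ ((r - 1) ^ (m - 1)) \<le> h * W p" using h by (intro mult_left_mono) auto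
  then have "norm j * (h * real r ^ 5 * max 1 (norm j) ^ r) ^ (r - 2) \<le> norm j * U p ^ (r - 2)"
    using thr h by (simp add: W_def mult.commute)
  then have "(h * real r ^ 5 * max 1 (norm j) ^ r) ^ (r - 2) \<le> U p ^ (r - 2)" using j by simp
  then have large: "h * real r ^ 5 * max 1 (norm j) ^ r \<le> U p"
    using r_ge_5 power_mono_iff[of _ "U p" "r - 2"] h by (simp add: U_def)
  have "v p \<noteq> 0" "v b \<noteq> 0" using cls pX by (auto simp: in_class_def)
  then show False
    using hypergeometric_contradiction[of \<omega> h p b] near pX h X(2) F0 large b(2) p(1) by (auto simp: U_def)
qed

lemma at_most_classes:
  assumes cop: "\<And>x y. (x, y) \<in> S \<Longrightarrow> coprime x y"
    and cls: "\<And>p. p \<in> S \<Longrightarrow> \<exists>\<omega>. in_class \<omega> h p" and F0: "\<And>p. p \<in> S \<Longrightarrow> F p \<noteq> 0"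
    and big: "\<And>p. p \<in> S \<Longrightarrow> 5 / 3 * h * E \<le> norm (u p) ^ (r - 2)"
    and h: "h \<ge> 1" and E: "E \<ge> 1" and m: "m \<ge> 3"
    and thr: "norm j * (h * real r ^ 5 * max 1 (norm j) ^ r) ^ (r - 2) \<le> h * (E * norm j) ^ ((r - 1) ^ (m - 1))"
    and \<Omega>: "finite \<Omega>" "card \<Omega> \<le> N" "\<And>p \<omega>. p \<in> S \<Longrightarrow> in_class \<omega> h p \<Longrightarrow> \<omega> \<in> \<Omega>"
  shows "at_most_up_to_sign S (N * m)"
proof (rule at_most_up_to_signI[OF cop])
  fix X assume X: "X \<subseteq> S" "finite X"
    "\<And>p q. p \<in> X \<Longrightarrow> q \<in> X \<Longrightarrow> p \<noteq> q \<Longrightarrow> fst p * snd q - snd p * fst q \<noteq> 0"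
  \<comment> \<open>Membership in a class need not be unique; choosing one \<omega> for each
    solution makes the pigeonhole principle applicable.\<close>
  define f where "f p = (SOME \<omega>. in_class \<omega> h p)" for p
  have f: "in_class (f p) h p" if "p \<in> S" for p unfolding f_def by (rule someI_ex[OF cls[OF that]])
  show "card X \<le> N * m"
  proof (cases "X = {}")
    case False
    then have "\<Omega> \<noteq> {}" using X(1) f \<Omega>(3) by blast
    moreover have "f \<in> X \<rightarrow> \<Omega>" using X(1) f \<Omega>(3) by blast
    ultimately obtain \<omega> where \<omega>: "card X \<le> card (f -` {\<omega>} \<inter> X) * card \<Omega>"
      using pigeonhole_card[of f X \<Omega>] X(2) \<Omega>(1) by blast
    have "card (f -` {\<omega>} \<inter> X) \<le> m"
    proof (rule card_class_le[OF _ _ _ _ _ h E m thr])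
      show "finite (f -` {\<omega>} \<inter> X)" using X(2) by simp
      show "det2 p q \<noteq> 0" if "p \<in> f -` {\<omega>} \<inter> X" "q \<in> f -` {\<omega>} \<inter> X" "p \<noteq> q" for p q
        unfolding det2_def using X(3) that by blast
      show "in_class \<omega> h p" if "p \<in> f -` {\<omega>} \<inter> X" for p using f[of p] that X(1) by auto
    qed (use F0 big X(1) in auto)
    then have "card (f -` {\<omega>} \<inter> X) * card \<Omega> \<le> m * N" using \<Omega>(2) by (intro mult_mono) auto
    then show ?thesis using \<omega> by (simp add: mult.commute)
  qed simp
qed auto

text \<open>With \<open>w = \<omega> * v p / u p\<close> real, it suffices to find a real point with
  \<open>v p * ?u = w * (u p * ?v)\<close>. Cross sum and cross difference with \<open>p\<close> are
  \<kappa> times real linear forms of the point, so this is a single real linear equation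
  \<open>c1 * x + c2 * y = 0\<close>, which has a nontrivial solution.\<close>

lemma real_zero_if_in_class:
  assumes "in_class \<omega> h p" "D > 0"
  shows "\<exists>x y :: real. (x, y) \<noteq> (0, 0) \<and>
    (\<alpha> * of_real x + \<beta> * of_real y) ^ r = (\<gamma> * of_real x + \<delta> * of_real y) ^ r"
proof -
  have nz: "u p \<noteq> 0" "v p \<noteq> 0" and \<omega>: "\<omega> ^ r = 1" and wR: "\<omega> * v p / u p \<in> \<real>"
    using assms by (auto simp: in_class_def near_def)
  obtain w where w: "\<omega> * v p / u p = of_real w" using wR by (auto simp: Reals_def)
  obtain t where t: "s = of_real t" using s_Reals[OF assms(2)] by (auto simp: Reals_def)
  define a1 a2 p1 p2 where "a1 = real_of_int (2 * A * fst p + B * snd p)"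
    and "a2 = real_of_int (B * fst p + 2 * C * snd p)" and "p1 = real_of_int (fst p)" and "p2 = real_of_int (snd p)"
  define c1 c2 where "c1 = (1 - w) * a1 + (1 + w) * t * p2" and "c2 = (1 - w) * a2 - (1 + w) * t * p1"
  have "\<exists>x y. (x, y) \<noteq> (0, 0) \<and> c1 * x + c2 * y = 0"
  proof (cases "c1 = 0 \<and> c2 = 0")
    case True
    then show ?thesis by (intro exI[of _ 1]) auto
  next
    case False
    then show ?thesis by (intro exI[of _ c2] exI[of _ "- c1"]) auto
  qed
  then obtain x y where xy: "(x, y) \<noteq> (0, 0)" "c1 * x + c2 * y = 0" by blast
  let ?u = "\<alpha> * of_real x + \<beta> * of_real y" and ?v = "\<gamma> * of_real x + \<delta> * of_real y"
  have diff: "u p * ?v - v p * ?u = \<kappa> * of_real (t * (p1 * y - p2 * x))"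
  proof -
    have "u p * ?v - v p * ?u = j * of_real (p1 * y - p2 * x)"
      by (simp add: u_def v_def j_def p1_def p2_def algebra_simps)
    then show ?thesis unfolding chi_s[symmetric] t by simp
  qed
  have sum: "u p * ?v + v p * ?u = \<kappa> * of_real (a1 * x + a2 * y)"
  proof -
    have "u p * ?v + v p * ?u = (2 * (\<alpha> * \<gamma>) * of_real p1 + (\<alpha> * \<delta> + \<beta> * \<gamma>) * of_real p2) * of_real x
       + ((\<alpha> * \<delta> + \<beta> * \<gamma>) * of_real p1 + 2 * (\<beta> * \<delta>) * of_real p2) * of_real y"
      by (simp add: u_def v_def p1_def p2_def algebra_simps)
    then show ?thesis unfolding prod_A prod_B prod_C
      by (simp add: a1_def a2_def p1_def p2_def algebra_simps)
  qed
  have "2 * (v p * ?u - of_real w * (u p * ?v)) =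
     of_real (1 - w) * (u p * ?v + v p * ?u) - of_real (1 + w) * (u p * ?v - v p * ?u)"
    by (simp add: algebra_simps)
  also have "\<dots> = \<kappa> * of_real (c1 * x + c2 * y)"
    unfolding diff sum c1_def c2_def by (simp add: algebra_simps)
  finally have "v p * ?u = of_real w * (u p * ?v)" unfolding xy(2) by simp
  also have "\<dots> = v p * (\<omega> * ?v)" unfolding w[symmetric] using nz by simp
  finally have "?u = \<omega> * ?v" using nz by simp
  then have "?u ^ r = ?v ^ r" using \<omega> by (simp add: power_mult_distrib)
  then show ?thesis using xy(1) by blast
qed

end

section \<open>Evaluation of forms and their derivatives\<close>

lemma eval2_add: "eval2 (P + Q) x y = eval2 P x y + eval2 Q x y"
  by (simp add: eval2_def)

lemma eval2_diff: "eval2 (P - Q) x y = eval2 P x y - eval2 Q x y"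
  by (simp add: eval2_def)

lemma eval2_mult: "eval2 (P * Q) x y = eval2 P x y * eval2 Q x y"
  by (simp add: eval2_def)

lemma eval2_power: "eval2 (P ^ n) x y = eval2 P x y ^ n"
  by (simp add: eval2_def)

lemma eval2_smult_const: "eval2 (smult [:c:] P) x y = c * eval2 P x y"
  by (simp add: eval2_def)

lemma eval2_linear_form: "eval2 (linear_form a b) x y = a * x + b * y"
  by (simp add: eval2_def linear_form_def algebra_simps)

lemma eval2_quadratic_form:
  "eval2 (quadratic_form a b c) x y = a * x\<^sup>2 + b * x * y + c * y\<^sup>2"
  by (simp add: eval2_def quadratic_form_def algebra_simps power2_eq_square)

lemma eval2_0: "eval2 0 x y = 0"
  by (simp add: eval2_def)

lemma eval2_pCons: "eval2 (pCons p P) x y = poly p x + y * eval2 P x y"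
  by (simp add: eval2_def)

lemma of_int_poly2_pCons: "of_int_poly2 (pCons p P) = pCons (map_poly of_int p) (of_int_poly2 P)"
  by (cases "p = 0 \<and> P = 0") (auto simp: of_int_poly2_def map_poly_pCons)

lemma of_int_poly2_0: "of_int_poly2 0 = 0"
  by (simp add: of_int_poly2_def)

lemma eval2_of_int_poly2:
  "eval2 (of_int_poly2 P) (of_int x) (of_int y) = of_int (eval2 P x y)"
proof (induction P)
  case (pCons p P)
  have "poly (map_poly of_int p) (of_int x) = of_int (poly p x)" for p
    by (induction p) (simp_all add: map_poly_pCons)
  then show ?case using pCons by (simp add: of_int_poly2_pCons eval2_pCons)
qed (simp add: of_int_poly2_0 eval2_0)

lemma of_real_eval2_of_int_poly2:
  "of_real (eval2 (of_int_poly2 P) x y) = (eval2 (of_int_poly2 P) (of_real x) (of_real y) :: complex)"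
proof (induction P)
  case (pCons p P)
  have "of_real (poly (map_poly of_int p) x) = poly (map_poly of_int p) (of_real x :: complex)" for p
    by (induction p) (simp_all add: map_poly_pCons)
  then show ?case using pCons by (simp add: of_int_poly2_pCons eval2_pCons)
qed (simp add: of_int_poly2_0 eval2_0)

text \<open>\<open>partial_x\<close> is confined to integer coefficients, while the powers of the
  linear forms have complex ones.\<close>

definition deriv_x :: "'a::idom poly poly \<Rightarrow> 'a poly poly" where
  "deriv_x P = map_poly pderiv P"

lemma deriv_x_pCons: "deriv_x (pCons p P) = pCons (pderiv p) (deriv_x P)"
  by (cases "p = 0 \<and> P = 0") (auto simp: deriv_x_def map_poly_pCons)

lemma deriv_x_0: "deriv_x 0 = 0"
  by (simp add: deriv_x_def)

lemma deriv_x_add: "deriv_x (P + Q) = deriv_x P + deriv_x Q"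
  by (rule poly_eqI) (simp add: deriv_x_def coeff_map_poly pderiv_add)

lemma deriv_x_diff: "deriv_x (P - Q) = deriv_x P - deriv_x Q"
  by (rule poly_eqI) (simp add: deriv_x_def coeff_map_poly pderiv_diff)

lemma deriv_x_smult: "deriv_x (smult p P) = smult p (deriv_x P) + smult (pderiv p) P"
  by (rule poly_eqI) (simp add: deriv_x_def coeff_map_poly pderiv_mult algebra_simps)

lemma deriv_x_mult: "deriv_x (P * Q) = deriv_x P * Q + P * deriv_x Q"
proof (induction P)
  case (pCons p P)
  have c: "deriv_x (pCons 0 R) = pCons 0 (deriv_x R)" for R :: "'a poly poly"
    by (simp add: deriv_x_pCons)
  show ?case
    unfolding mult_pCons_left deriv_x_add deriv_x_smult c pCons.IH deriv_x_pCons
    by (simp add: algebra_simps)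
qed (simp add: deriv_x_0)

lemma deriv_x_linear_form_power:
  "deriv_x (linear_form a b ^ n) = smult [:of_nat n * a:] (linear_form a b ^ (n - 1))"
proof (induction n)
  case 0
  have "deriv_x (1 :: 'a poly poly) = 0"
    unfolding one_pCons deriv_x_pCons by (simp add: deriv_x_0)
  then show ?case by simp
next
  case (Suc n)
  have d: "deriv_x (linear_form a b) = [:[:a:]:]"
    by (simp add: linear_form_def deriv_x_pCons deriv_x_0 pderiv_pCons)
  show ?case
  proof (cases n)
    case 0
    then show ?thesis by (simp add: d)
  next
    case (Suc k)
    have "deriv_x (linear_form a b ^ Suc n) = [:[:a:]:] * linear_form a b ^ n + linear_form a b * smult [:of_nat n * a:] (linear_form a b ^ k)"
      unfolding power_Suc deriv_x_mult d using Suc.IH Suc by simp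
    also have "\<dots> = smult [:a:] (linear_form a b ^ n) + smult [:of_nat n * a:] (linear_form a b ^ n)"
      using Suc by simp
    also have "\<dots> = smult [:of_nat (Suc n) * a:] (linear_form a b ^ n)"
      by (simp add: algebra_simps flip: smult_add_left)
    finally show ?thesis by simp
  qed
qed

lemma pderiv_linear_form_power:
  "pderiv (linear_form a b ^ n) = smult [:of_nat n * b:] (linear_form a b ^ (n - 1))"
proof (cases n)
  case (Suc k)
  have "pderiv (linear_form a b) = [:[:b:]:]" by (simp add: linear_form_def pderiv_pCons)
  then show ?thesis unfolding Suc pderiv_power_Suc
    by (simp add: of_nat_poly mult_ac smult_smult del: of_nat_Suc)
qed simp

lemma of_int_poly2_partial_x: "of_int_poly2 (partial_x P) = deriv_x (of_int_poly2 P)"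
proof (induction P)
  case (pCons p P)
  have "map_poly of_int (pderiv p) = pderiv (map_poly of_int p)" for p :: "int poly"
    by (rule poly_eqI) (simp add: coeff_map_poly coeff_pderiv)
  moreover have "partial_x (pCons p P) = pCons (pderiv p) (partial_x P)"
    by (cases "p = 0 \<and> P = 0") (auto simp: partial_x_def map_poly_pCons)
  ultimately show ?case using pCons by (simp add: of_int_poly2_pCons deriv_x_pCons)
qed (simp add: of_int_poly2_0 deriv_x_0 partial_x_def)

lemma coeff_of_nat_mult: "coeff (of_nat k * p) i = of_nat k * coeff p i"
  by (simp add: of_nat_poly)

lemma of_int_poly2_partial_y: "of_int_poly2 (partial_y P) = pderiv (of_int_poly2 P)"
  unfolding of_int_poly2_def partial_y_def
  by (intro poly_eqI) (simp add: coeff_map_poly coeff_pderiv coeff_of_nat_mult del: of_nat_Suc)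

lemma eval2_partial_of_difference_of_powers:
  fixes F :: "int poly poly" and \<alpha> \<beta> \<gamma> \<delta> :: complex and x y :: int
  assumes "of_int_poly2 F = linear_form \<alpha> \<beta> ^ r - linear_form \<gamma> \<delta> ^ r"
  defines "u \<equiv> \<alpha> * of_int x + \<beta> * of_int y" and "v \<equiv> \<gamma> * of_int x + \<delta> * of_int y"
  shows "of_int (eval2 F x y) = u ^ r - v ^ r"
    and "of_int (eval2 (partial_x F) x y) = of_nat r * (\<alpha> * u ^ (r - 1) - \<gamma> * v ^ (r - 1))"
    and "of_int (eval2 (partial_y F) x y) = of_nat r * (\<beta> * u ^ (r - 1) - \<delta> * v ^ (r - 1))"
    and "of_int (eval2 (hessian F) x y) =
      - (of_nat r * of_nat (r - 1) * (\<alpha> * \<delta> - \<beta> * \<gamma>))\<^sup>2 * (u * v) ^ (r - 2)"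
proof -
  note ev = eval2_of_int_poly2[symmetric] of_int_poly2_partial_x of_int_poly2_partial_y assms(1)
    deriv_x_diff deriv_x_smult deriv_x_linear_form_power pderiv_diff pderiv_smult pderiv_linear_form_power
    eval2_diff eval2_add eval2_smult_const eval2_power eval2_linear_form
  show "of_int (eval2 F x y) = u ^ r - v ^ r"
    unfolding ev u_def v_def ..
  show "of_int (eval2 (partial_x F) x y) = of_nat r * (\<alpha> * u ^ (r - 1) - \<gamma> * v ^ (r - 1))"
    unfolding ev u_def v_def by (simp add: algebra_simps)
  show "of_int (eval2 (partial_y F) x y) = of_nat r * (\<beta> * u ^ (r - 1) - \<delta> * v ^ (r - 1))"
    unfolding ev u_def v_def by (simp add: algebra_simps)
  have c0: "smult (pderiv [:c:]) P = 0" for c :: complex and P by (simp add: pderiv_pCons)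
  let ?n = "of_nat r * of_nat (r - 1) :: complex"
  have r2: "r - 1 - 1 = r - 2" by simp
  have xx: "of_int (eval2 (partial_x (partial_x F)) x y) = ?n * (\<alpha>\<^sup>2 * u ^ (r - 2) - \<gamma>\<^sup>2 * v ^ (r - 2))"
    unfolding ev u_def v_def c0 r2 eval2_0 by (simp add: algebra_simps power2_eq_square)
  have yy: "of_int (eval2 (partial_y (partial_y F)) x y) = ?n * (\<beta>\<^sup>2 * u ^ (r - 2) - \<delta>\<^sup>2 * v ^ (r - 2))"
    unfolding ev u_def v_def c0 r2 eval2_0 by (simp add: algebra_simps power2_eq_square)
  have xy: "of_int (eval2 (partial_y (partial_x F)) x y) = ?n * (\<alpha> * \<beta> * u ^ (r - 2) - \<gamma> * \<delta> * v ^ (r - 2))"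
    unfolding ev u_def v_def c0 r2 eval2_0 by (simp add: algebra_simps power2_eq_square)
  have "of_int (eval2 (hessian F) x y) = of_int (eval2 (partial_x (partial_x F)) x y) * of_int (eval2 (partial_y (partial_y F)) x y)
     - (of_int (eval2 (partial_y (partial_x F)) x y) :: complex)\<^sup>2"
    by (simp add: hessian_def eval2_diff eval2_mult eval2_power)
  \<comment> \<open>The squares of \<open>u ^ (r - 2)\<close> and \<open>v ^ (r - 2)\<close> cancel;
    the mixed term carries minus the square of the determinant.\<close>
  also have "\<dots> = - (?n * (\<alpha> * \<delta> - \<beta> * \<gamma>))\<^sup>2 * (u ^ (r - 2) * v ^ (r - 2))"
    unfolding xx yy xy by (simp add: algebra_simps power2_eq_square)
  finally show "of_int (eval2 (hessian F) x y) =
      - (of_nat r * of_nat (r - 1) * (\<alpha> * \<delta> - \<beta> * \<gamma>))\<^sup>2 * (u * v) ^ (r - 2)"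
    by (simp add: power_mult_distrib)
qed

section \<open>Reduction to a primitive quadratic form and the four cases\<close>

theorem theorem1p8:
  fixes F :: "int poly poly" and r h m :: nat
    and \<alpha> \<beta> \<gamma> \<delta> j c :: complex and A B C D :: int
    and S :: "(int \<times> int) set"
  assumes "binary_form r F" and "r \<ge> 5"
    and "diagonalization r F \<alpha> \<beta> \<gamma> \<delta>"
    and "j = \<alpha> * \<delta> - \<beta> * \<gamma>"
    and "associated_quadratic \<alpha> \<beta> \<gamma> \<delta> c A B C"
    and "D = B\<^sup>2 - 4 * A * C"
    and "h > 0" and "m \<ge> 3"
    and "S = primitive_solutions F h (H_L r h m (cmod j))"
  shows "(D < 0 \<longrightarrow> at_most_up_to_sign S (r * m)) \<and>
         (D > 0 \<and> even r \<and> indefinite_form F \<longrightarrow> at_most_up_to_sign S (2 * m)) \<and>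
         (D > 0 \<and> odd r \<and> indefinite_form F \<longrightarrow> at_most_up_to_sign S m) \<and>
         (D > 0 \<and> definite_form F \<longrightarrow> at_most_up_to_sign S 1)"
proof -
  have diag: "of_int_poly2 F = linear_form \<alpha> \<beta> ^ r - linear_form \<gamma> \<delta> ^ r" and j0: "j \<noteq> 0"
    using assms(3,4) by (auto simp: diagonalization_def)
  note partials = eval2_partial_of_difference_of_powers[OF diag]
  have quad: "(\<alpha> * x + \<beta> * y) * (\<gamma> * x + \<delta> * y) = c * (of_int A * x\<^sup>2 + of_int B * x * y + of_int C * y\<^sup>2)" for x y
    using arg_cong[OF assms(5)[unfolded associated_quadratic_def], of "\<lambda>P. eval2 P x y"]
    by (simp add: eval2_mult eval2_linear_form eval2_smult_const eval2_quadratic_form)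
  have prods: "\<alpha> * \<gamma> = c * of_int A" "\<beta> * \<delta> = c * of_int C"
    using quad[of 1 0] quad[of 0 1] by simp_all
  have prodB: "\<alpha> * \<delta> + \<beta> * \<gamma> = c * of_int B"
    using quad[of 1 1] prods by (simp add: algebra_simps)
  \<comment> \<open>The given \<open>A\<close>, \<open>B\<close>, \<open>C\<close> may have a common
    factor; it is moved into the constant because integrality of \<kappa>^r requires a primitive
    quadratic form.\<close>
  define g where "g = gcd A (gcd B C)"
  define A' B' C' where "A' = A div g" and "B' = B div g" and "C' = C div g"
  have j2: "j\<^sup>2 = c\<^sup>2 * of_int D"
  proof -
    have "j\<^sup>2 = (\<alpha> * \<delta> + \<beta> * \<gamma>)\<^sup>2 - 4 * (\<alpha> * \<gamma>) * (\<beta> * \<delta>)"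
      unfolding assms(4) by (simp add: power2_eq_square algebra_simps)
    then show ?thesis unfolding prods prodB assms(6) by (simp add: power2_eq_square algebra_simps)
  qed
  then have c0: "c \<noteq> 0" and D0: "D \<noteq> 0" using j0 by auto
  have g0: "g \<noteq> 0"
  proof
    assume "g = 0"
    then have "A = 0" "B = 0" "C = 0" by (auto simp: g_def)
    then show False using D0 assms(6) by simp
  qed
  have dvd: "g dvd A" "g dvd B" "g dvd C" by (auto simp: g_def intro: dvd_trans[OF gcd_dvd2])
  then have ABC: "A = g * A'" "B = g * B'" "C = g * C'" by (auto simp: A'_def B'_def C'_def)
  let ?\<kappa> = "c * of_int g"
  have \<kappa>0: "?\<kappa> \<noteq> 0" using c0 g0 by simp
  interpret L: diagonal_form r \<alpha> \<beta> \<gamma> \<delta> ?\<kappa> A' B' C' "\<lambda>(x, y). eval2 F x y"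
  proof
    show "\<alpha> * \<delta> - \<beta> * \<gamma> \<noteq> 0" using j0 assms(4) by simp
    show PA: "\<alpha> * \<gamma> = ?\<kappa> * of_int A'" and PB: "\<alpha> * \<delta> + \<beta> * \<gamma> = ?\<kappa> * of_int B'"
      and PC: "\<beta> * \<delta> = ?\<kappa> * of_int C'"
      using prods prodB ABC by (metis mult.assoc of_int_mult)+
    have "g * gcd A' (gcd B' C') = g"
    proof -
      have "\<bar>g\<bar> = g" by (simp add: g_def)
      then have gm: "gcd (g * a) (g * b) = g * gcd a b" for a b
        using gcd_mult_distrib_int[of g a b] by simp
      have "g = gcd A (gcd B C)" by (rule g_def)
      also have "\<dots> = g * gcd A' (gcd B' C')" unfolding ABC gm ..
      finally show ?thesis ..
    qed
    then show "gcd A' (gcd B' C') = 1" using g0 by simp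
    show "of_int (case (x, y) of (x, y) \<Rightarrow> eval2 F x y) =
        (\<alpha> * of_int x + \<beta> * of_int y) ^ r - (\<gamma> * of_int x + \<delta> * of_int y) ^ r" for x y
      using partials(1) by simp
    show "\<exists>z. of_nat r * ((\<alpha> * \<delta> - \<beta> * \<gamma>) / ?\<kappa>) *
      ((\<alpha> * of_int x + \<beta> * of_int y) ^ r + (\<gamma> * of_int x + \<delta> * of_int y) ^ r) = of_int z" for x y
    proof
      let ?u = "\<alpha> * of_int x + \<beta> * of_int y" and ?v = "\<gamma> * of_int x + \<delta> * of_int y"
      \<comment> \<open>The partial derivatives of the primitive quadratic form. Paired with those
        of \<open>F\<close> in a determinant, they give the integer witness for
        \<open>theta_int\<close>.\<close>
      let ?Qx = "2 * A' * x + B' * y" and ?Qy = "B' * x + 2 * C' * y"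
      have Qx: "?\<kappa> * of_int ?Qx = \<alpha> * ?v + \<gamma> * ?u"
      proof -
        have "\<alpha> * ?v + \<gamma> * ?u = 2 * (\<alpha> * \<gamma>) * of_int x + (\<alpha> * \<delta> + \<beta> * \<gamma>) * of_int y" by (simp add: algebra_simps)
        then show ?thesis unfolding PA PB by (simp add: algebra_simps)
      qed
      have Qy: "?\<kappa> * of_int ?Qy = \<beta> * ?v + \<delta> * ?u"
      proof -
        have "\<beta> * ?v + \<delta> * ?u = (\<alpha> * \<delta> + \<beta> * \<gamma>) * of_int x + 2 * (\<beta> * \<delta>) * of_int y" by (simp add: algebra_simps)
        then show ?thesis unfolding PB PC by (simp add: algebra_simps)
      qed
      have pow: "?u ^ r = ?u * ?u ^ (r - 1)" "?v ^ r = ?v * ?v ^ (r - 1)" using assms(2) by (simp_all flip: power_Suc)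
      have "?\<kappa> * of_int (eval2 (partial_x F) x y * ?Qy - eval2 (partial_y F) x y * ?Qx) =
        of_int (eval2 (partial_x F) x y) * (?\<kappa> * of_int ?Qy) - of_int (eval2 (partial_y F) x y) * (?\<kappa> * of_int ?Qx)"
        by (simp add: algebra_simps)
      also have "\<dots> = of_nat r * (\<alpha> * \<delta> - \<beta> * \<gamma>) * (?u ^ r + ?v ^ r)"
        unfolding Qx Qy partials pow by (simp add: algebra_simps)
      finally show "of_nat r * ((\<alpha> * \<delta> - \<beta> * \<gamma>) / ?\<kappa>) * (?u ^ r + ?v ^ r) =
         of_int (eval2 (partial_x F) x y * ?Qy - eval2 (partial_y F) x y * ?Qx)"
        using \<kappa>0 by (simp only: times_divide_eq_right times_divide_eq_left divide_eq_eq) (simp add: mult.commute)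
    qed
  qed (fact assms(2))
  have Lj: "L.j = j" by (simp add: L.j_def assms(4))
  \<comment> \<open>The discriminant changes by a nonzero square, so the distinction by its sign is
    unaffected.\<close>
  have LD: "D = g\<^sup>2 * L.D" unfolding assms(6) L.D_def ABC by (simp add: power2_eq_square algebra_simps)
  have sgnD: "D > 0 \<longleftrightarrow> L.D > 0" using g0 by (simp add: LD zero_less_mult_iff)
  have J: "cmod j > 0" using j0 by simp
  obtain E where E: "E \<ge> 1"
    "\<And>P. H_L r h m (cmod j) \<le> (real r)\<^sup>2 * (real r - 1)\<^sup>2 * (cmod j)\<^sup>2 * P \<Longrightarrow> (8 / 3 * real h * E)\<^sup>2 \<le> P"
    "cmod j * (real h * real r ^ 5 * max 1 (cmod j) ^ r) ^ (r - 2) \<le> real h * (E * cmod j) ^ ((r - 1) ^ (m - 1))"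
    using H_L_threshold[OF assms(2,7,8) J] by blast
  have h1: "real h \<ge> 1" using assms(7) by simp
  have S: "coprime x y" "eval2 F x y \<noteq> 0" "\<bar>real_of_int (eval2 F x y)\<bar> \<le> real h"
     "norm (L.u (x, y)) ^ r \<ge> 5 / 3 * real h" "norm (L.u (x, y)) ^ (r - 2) \<ge> 5 / 3 * real h * E"
    if xy: "(x, y) \<in> S" for x y
  proof -
    show "coprime x y" "eval2 F x y \<noteq> 0" using xy unfolding assms(9) primitive_solutions_def by auto
    have "\<bar>eval2 F x y\<bar> \<le> int h" using xy unfolding assms(9) primitive_solutions_def by auto
    then show Fh: "\<bar>real_of_int (eval2 F x y)\<bar> \<le> real h" by linarith
    let ?U = "norm (L.u (x, y))" and ?V = "norm (L.v (x, y))"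
    have "norm (L.u (x, y) ^ r - L.v (x, y) ^ r) = \<bar>real_of_int (eval2 F x y)\<bar>"
      using L.F_uv[of "(x, y)"] by (metis norm_of_int case_prod_conv)
    then have d: "\<bar>?U ^ r - ?V ^ r\<bar> \<le> real h"
      using norm_triangle_ineq3[of "L.u (x, y) ^ r" "L.v (x, y) ^ r"] Fh by (simp add: norm_power)
    have "H_L r h m (cmod j) \<le> \<bar>real_of_int (eval2 (hessian F) x y)\<bar>"
      using xy unfolding assms(9) primitive_solutions_def by simp
    also have "\<bar>real_of_int (eval2 (hessian F) x y)\<bar> = norm (of_int (eval2 (hessian F) x y) :: complex)" by simp
    also have "\<dots> = (real r)\<^sup>2 * (real r - 1)\<^sup>2 * (cmod j)\<^sup>2 * (?U * ?V) ^ (r - 2)"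
    proof -
      have "norm (of_nat (r - 1) :: complex) = real r - 1"
        unfolding norm_of_nat using assms(2) by (simp add: of_nat_diff)
      then show ?thesis unfolding partials(4)
        by (simp only: norm_mult norm_power norm_minus_cancel norm_of_nat L.u_def L.v_def fst_conv snd_conv
            assms(4) power_mult_distrib mult_ac)
    qed
    finally have big: "(8 / 3 * real h * E)\<^sup>2 \<le> (?U * ?V) ^ (r - 2)" by (rule E(2))
    show "?U ^ r \<ge> 5 / 3 * real h" "?U ^ (r - 2) \<ge> 5 / 3 * real h * E"
      using large_linear_factor[OF _ _ d big h1 E(1) assms(2)] by auto
  qed
  have cls: "\<exists>\<omega>. L.in_class \<omega> (real h) p" if "p \<in> S" for p
  proof -
    obtain x y where p: "p = (x, y)" by (cases p)
    show ?thesis using L.exists_class[of p "real h"] S that h1 unfolding p by simp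
  qed
  have count: "at_most_up_to_sign S (N * m)"
    if "finite \<Omega>" "card \<Omega> \<le> N" "\<And>p \<omega>. p \<in> S \<Longrightarrow> L.in_class \<omega> (real h) p \<Longrightarrow> \<omega> \<in> \<Omega>" for \<Omega> N
  proof (rule L.at_most_classes[OF S(1) cls _ _ h1 E(1) assms(8) _ that])
    show "cmod L.j * (real h * real r ^ 5 * max 1 (cmod L.j) ^ r) ^ (r - 2) \<le> real h * (E * cmod L.j) ^ ((r - 1) ^ (m - 1))"
      unfolding Lj by (rule E(3))
  qed (use S in auto)
  have empty: "at_most_up_to_sign S n" if "S = {}" for n
    using that by (simp add: at_most_up_to_sign_def up_to_sign_def)
  have neg: "at_most_up_to_sign S (r * m)"
  proof (rule count)
    show "finite {z :: complex. z ^ r = 1}" using assms(2) by (intro finite_roots_unity) auto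
    show "card {z :: complex. z ^ r = 1} \<le> r" using assms(2) by (intro card_roots_unity) auto
  qed (auto simp: L.in_class_def)
  have even: "at_most_up_to_sign S (2 * m)" if "D > 0"
  proof (cases "S = {}")
    case False
    then obtain p \<omega> where p: "p \<in> S" "L.in_class \<omega> (real h) p" using cls by blast
    show ?thesis
    proof (rule count)
      show "finite {\<omega>, - \<omega>}" "card {\<omega>, - \<omega>} \<le> 2" by (auto simp: card_insert_if)
    qed (use L.class_unique_up_to_sign(1)[OF p(2)] that sgnD in blast)
  qed (rule empty)
  have odd: "at_most_up_to_sign S (1 * m)" if "D > 0" "odd r"
  proof (cases "S = {}")
    case False
    then obtain p \<omega> where p: "p \<in> S" "L.in_class \<omega> (real h) p" using cls by blast
    show ?thesis
    proof (rule count)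
      show "finite {\<omega>}" "card {\<omega>} \<le> 1" by auto
    qed (use L.class_unique_up_to_sign(2)[OF p(2)] that sgnD in blast)
  qed (rule empty)
  have definite: "S = {}" if "D > 0" "definite_form F"
  proof (rule ccontr)
    assume "S \<noteq> {}"
    then obtain p \<omega> where "L.in_class \<omega> (real h) p" using cls by blast
    from L.real_zero_if_in_class[OF this] sgnD that(1) obtain x y :: real where xy: "(x, y) \<noteq> (0, 0)"
      "(\<alpha> * of_real x + \<beta> * of_real y) ^ r = (\<gamma> * of_real x + \<delta> * of_real y) ^ r" by blast
    have "of_real (eval2 (of_int_poly2 F) x y) = (0 :: complex)"
      unfolding of_real_eval2_of_int_poly2 diag eval2_diff eval2_power eval2_linear_form using xy(2) by simp
    then have "eval2 (of_int_poly2 F) x y = 0" by simp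
    moreover have "eval2 (of_int_poly2 F) x y > 0 \<or> eval2 (of_int_poly2 F) x y < 0"
      using that(2) xy(1) unfolding definite_form_def by blast
    ultimately show False by simp
  qed
  show ?thesis using neg even odd definite empty by auto
qed

end
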